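(* Let $I(\boldsymbol{B},\boldsymbol{r})$ be a diagonal blockwise determinantal ideal with $\boldsymbol{B}=(B_1,\dots,B_k)$ and $\boldsymbol{r}=(r_1,\dots,r_k)$, let $\mathcal{G}_i$ be the set of all $r_i$-minors in $B_i$ for $i=1,\dots,k$, and let $<$ be a lexicographic diagonal term order induced by a scanning variable order. Suppose that for each $G_i\in\mathcal{G}_i$ and $G_j\in\mathcal{G}_j$ with $i\ne j$ there exist $x_{cd}\in B_i\cap B_j$, $x_{ab}\in B_i$ and $x_{\tilde a\tilde b}\in B_j$ such that: (1) $R(G_i)\subseteq[c,a]$, $C(G_i)\subseteq[d,b]$, $R(G_j)\subseteq[c,\tilde a]$ and $C(G_j)\subseteq[d,\tilde b]$; (2) either $a\ge\tilde a$ and $b\le\tilde b$, or $a\le\tilde a$ and $b\ge\tilde b$. Then $\bigcup_{i=1}^k\mathcal{G}_i$ is a Gröbner basis of $I(\boldsymbol{B},\boldsymbol{r})$ with respect to $<$.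
   Context: Let $K$ be a field and $X=(x_{ij})$ a generic $m\times n$ matrix ($m\le n$) of distinct variables; $K[\boldsymbol{x}]$ is the polynomial ring in all $mn$ variables. For integers $p\le q$, $[p,q]=\{p,\dots,q\}$. A subset of $X$ means a set of entries. An $r$-minor $G$ of $X$ is the determinant of an $r\times r$ submatrix with row index set $R(G)$ and column index set $C(G)$ (arbitrary sets of size $r$); it is a minor in a subset $B$ if all entries of the submatrix belong to $B$. A non-empty subset $B$ of $X$ is diagonal if whenever $x_{pq},x_{\tilde p\tilde q}\in B$ with $p\le\tilde p$, $q\le\tilde q$, all $x_{ij}$ with $p\le i\le\tilde p$, $q\le j\le\tilde q$ belong to $B$. For a sequence $\boldsymbol{B}=(B_1,\dots,B_k)$ of non-empty subsets of $X$ (blocks) and a sequence $\boldsymbol{r}=(r_1,\dots,r_k)$ of positive integers, the blockwise determinantal ideal $I(\boldsymbol{B},\boldsymbol{r})\subseteq K[\boldsymbol{x}]$ is generated by all $r_i$-minors in $B_i$ for all $i$; it is diagonal when all blocks are diagonal. The scanning variable orders inducing lexicographic diagonal term orders are the four orders in which either the northwest corner $x_{11}$ is the greatest variable and the next greatest variables are determined by scanning row by row to the east (rows top to bottom) or column by column to the south (columns left to right), or the southeast corner $x_{mn}$ is the greatest and one scans row by row to the west (rows bottom to top) or column by column to the north (columns right to left). For such a term order the leading term of every minor is the product of its diagonal entries. It is a known fact, taken as given, that for each $i$ the set $\mathcal{G}_i$ is a Gröbner basis of the ideal it generates with respect to such an order. *)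

theory Defs
  imports "HOL-Library.Cardinality" "HOL-Library.Poly_Mapping" "Jordan_Normal_Form.Determinant"
begin

text \<open>
  The rows and columns of the generic matrix are indexed by finite linearly ordered types
  \<open>'m\<close> and \<open>'n\<close>, so that the \<open>m n\<close> variables are the elements of \<open>'m \<times> 'n\<close>, monomials are
  exponent functions, and the following type is the whole polynomial ring in these variables.
\<close>

type_synonym ('m, 'n, 'k) mpoly = "('m \<times> 'n \<Rightarrow>\<^sub>0 nat) \<Rightarrow>\<^sub>0 'k"

definition variable :: "'m \<times> 'n \<Rightarrow> ('m, 'n, 'k::field) mpoly" where
  "variable v = Poly_Mapping.single (Poly_Mapping.single v 1) 1"

definition power_product :: "('m \<times> 'n \<Rightarrow>\<^sub>0 nat) \<Rightarrow> ('m, 'n, 'k::field) mpoly" where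
  "power_product t = Poly_Mapping.single t 1"

definition ideal_gen :: "('m, 'n, 'k::field) mpoly set \<Rightarrow> ('m, 'n, 'k) mpoly set" where
  "ideal_gen G = Modules.module.span (*) G"


subsection \<open>Lexicographic term orders and Groebner bases\<close>

text \<open>Variable orders are given as relations \<open>gt\<close>, where \<open>gt v w\<close> means \<open>v > w\<close>.\<close>

definition lex_less ::
  "('v \<Rightarrow> 'v \<Rightarrow> bool) \<Rightarrow> ('v \<Rightarrow>\<^sub>0 nat) \<Rightarrow> ('v \<Rightarrow>\<^sub>0 nat) \<Rightarrow> bool" where
  "lex_less gt s t \<longleftrightarrow>
     (\<exists>v. Poly_Mapping.lookup s v < Poly_Mapping.lookup t v \<and>
        (\<forall>w. gt w v \<longrightarrow> Poly_Mapping.lookup s w = Poly_Mapping.lookup t w))"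

text \<open>Only meaningful for nonzero polynomials.\<close>

definition lead_exponent ::
  "('m \<times> 'n \<Rightarrow> 'm \<times> 'n \<Rightarrow> bool) \<Rightarrow> ('m, 'n, 'k::field) mpoly \<Rightarrow> ('m \<times> 'n \<Rightarrow>\<^sub>0 nat)" where
  "lead_exponent gt p =
     (THE t. t \<in> Poly_Mapping.keys p \<and>
        (\<forall>s \<in> Poly_Mapping.keys p. s \<noteq> t \<longrightarrow> lex_less gt s t))"

definition lead_ideal ::
  "('m \<times> 'n \<Rightarrow> 'm \<times> 'n \<Rightarrow> bool) \<Rightarrow> ('m, 'n, 'k::field) mpoly set \<Rightarrow> ('m, 'n, 'k) mpoly set" where
  "lead_ideal gt S = ideal_gen {power_product (lead_exponent gt p) | p. p \<in> S \<and> p \<noteq> 0}"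

definition groebner_basis ::
  "('m \<times> 'n \<Rightarrow> 'm \<times> 'n \<Rightarrow> bool) \<Rightarrow> ('m, 'n, 'k::field) mpoly set \<Rightarrow> ('m, 'n, 'k) mpoly set \<Rightarrow> bool"
where
  "groebner_basis gt G I \<longleftrightarrow> finite G \<and> G \<subseteq> I \<and> lead_ideal gt G = lead_ideal gt I"

text \<open>
  The suffix gives the corner carrying the greatest variable and the direction of the scan:
  row by row to the east, column by column to the south, row by row to the west,
  column by column to the north.
\<close>

definition gt_NW_rows :: "'m::linorder \<times> 'n::linorder \<Rightarrow> 'm \<times> 'n \<Rightarrow> bool" where
  "gt_NW_rows = (\<lambda>(i, j) (k, l). i < k \<or> i = k \<and> j < l)"

definition gt_NW_cols :: "'m::linorder \<times> 'n::linorder \<Rightarrow> 'm \<times> 'n \<Rightarrow> bool" where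
  "gt_NW_cols = (\<lambda>(i, j) (k, l). j < l \<or> j = l \<and> i < k)"

definition gt_SE_rows :: "'m::linorder \<times> 'n::linorder \<Rightarrow> 'm \<times> 'n \<Rightarrow> bool" where
  "gt_SE_rows = (\<lambda>(i, j) (k, l). i > k \<or> i = k \<and> j > l)"

definition gt_SE_cols :: "'m::linorder \<times> 'n::linorder \<Rightarrow> 'm \<times> 'n \<Rightarrow> bool" where
  "gt_SE_cols = (\<lambda>(i, j) (k, l). j > l \<or> j = l \<and> i > k)"

definition scanning_orders :: "('m::linorder \<times> 'n::linorder \<Rightarrow> 'm \<times> 'n \<Rightarrow> bool) set" where
  "scanning_orders = {gt_NW_rows, gt_NW_cols, gt_SE_rows, gt_SE_cols}"


subsection \<open>Blockwise determinantal ideals\<close>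

text \<open>
  Row and column index sets are enumerated increasingly.
  Only meaningful if \<open>R\<close> and \<open>C\<close> have the same size.
\<close>

definition minor ::
  "'m::{finite,linorder} set \<Rightarrow> 'n::{finite,linorder} set \<Rightarrow> ('m, 'n, 'k::field) mpoly" where
  "minor R C = det (mat (card R) (card R)
     (\<lambda>(i, j). variable (sorted_list_of_set R ! i, sorted_list_of_set C ! j)))"

definition minor_indices ::
  "('m::{finite,linorder} \<times> 'n::{finite,linorder}) set \<Rightarrow> nat \<Rightarrow> ('m set \<times> 'n set) set" where
  "minor_indices B r = {(R, C). card R = r \<and> card C = r \<and> R \<times> C \<subseteq> B}"

definition minors_in ::
  "('m::{finite,linorder} \<times> 'n::{finite,linorder}) set \<Rightarrow> nat \<Rightarrow> ('m, 'n, 'k::field) mpoly set" where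
  "minors_in B r = {minor R C | R C. (R, C) \<in> minor_indices B r}"

definition diagonal :: "('m::linorder \<times> 'n::linorder) set \<Rightarrow> bool" where
  "diagonal B \<longleftrightarrow> B \<noteq> {} \<and>
     (\<forall>p q p' q'. (p, q) \<in> B \<and> (p', q') \<in> B \<and> p \<le> p' \<and> q \<le> q' \<longrightarrow> {p..p'} \<times> {q..q'} \<subseteq> B)"

definition blockwise_minors ::
  "nat \<Rightarrow> (nat \<Rightarrow> ('m::{finite,linorder} \<times> 'n::{finite,linorder}) set) \<Rightarrow> (nat \<Rightarrow> nat) \<Rightarrow>
   ('m, 'n, 'k::field) mpoly set" where
  "blockwise_minors k B r = (\<Union>i\<in>{1..k}. minors_in (B i) (r i))"

definition blockwise_ideal ::
  "nat \<Rightarrow> (nat \<Rightarrow> ('m::{finite,linorder} \<times> 'n::{finite,linorder}) set) \<Rightarrow> (nat \<Rightarrow> nat) \<Rightarrow>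
   ('m, 'n, 'k::field) mpoly set" where
  "blockwise_ideal k B r = ideal_gen (blockwise_minors k B r)"

end

theory Submission
  imports Defs
begin

text \<open>
  The generators of each single block are already a Groebner basis of their ideal, so only the
  interaction of two blocks matters, and for this it suffices to exhibit one suitable polynomial for
  each pair of minors.

  Let \<open>I\<^sub>1, \<dots>, I\<^sub>k\<close> be ideals with Groebner bases \<open>G\<^sub>1, \<dots>, G\<^sub>k\<close>. If for all \<open>i \<noteq> j\<close>, \<open>g \<in> G\<^sub>i\<close> and \<open>g' \<in> G\<^sub>j\<close>
  the intersection of \<open>I\<^sub>i\<close> and \<open>I\<^sub>j\<close> contains a polynomial \<open>h\<close> whose leading monomial divides the
  least common multiple of the leading monomials of \<open>g\<close> and \<open>g'\<close>, then the union of the \<open>G\<^sub>i\<close> is a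
  Groebner basis of the sum of the ideals. In an expression \<open>f = f\<^sub>1 + \<dots> + f\<^sub>k\<close> with \<open>f\<^sub>i \<in> I\<^sub>i\<close>, leading
  terms that cancel between \<open>f\<^sub>i\<close> and \<open>f\<^sub>j\<close> can be removed by exchanging a multiple of such an \<open>h\<close>
  between the two summands; as the lexicographic order is well-founded, after finitely many
  exchanges the leading monomial of \<open>f\<close> is that of an element of a single \<open>I\<^sub>i\<close>. This is
  \<open>lead_of_sum_of_ideals\<close> and \<open>groebner_basis_Union\<close>.

  For minors in two blocks, the hypothesis provides two rectangles with a common northwest corner,
  one in each block and each containing one of the minors, one of them taller and the other one
  wider. The polynomial \<open>h\<close> is the determinant of a block matrix
  \<open>[[*, *, *], [*, *, 0], [*, *, *]]\<close>. Its three groups of rows and columns belong to points on the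
  two diagonals: a common beginning inside both rectangles, the rest of the diagonal in the tall
  rectangle, and the rest of the diagonal in the wide rectangle. The zero block stands where entries
  could leave both rectangles. Laplace expansion along the last group of columns shows that \<open>h\<close> lies in
  the ideal of the tall rectangle, and along the middle group of rows that it lies in the ideal of
  the wide one (\<open>ex_common_multiple\<close>). In spite of the zero block the leading monomial of \<open>h\<close> is the
  product of its diagonal for each of the scanning orders (\<open>leads_det_zero_corner_matrix\<close>), and all
  diagonal entries are taken from the two given diagonals.
\<close>

section \<open>Lexicographic orders and leading monomials\<close>

locale variable_order =
  fixes gt :: "'v::finite \<Rightarrow> 'v \<Rightarrow> bool"
  assumes gt_irrefl: "\<not> gt v v"
    and gt_trans: "gt u v \<Longrightarrow> gt v w \<Longrightarrow> gt u w"
    and gt_total: "u \<noteq> v \<Longrightarrow> gt u v \<or> gt v u"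
begin

lemma ex_greatest:
  assumes "V \<noteq> {}"
  shows "\<exists>v\<in>V. \<forall>w\<in>V. w \<noteq> v \<longrightarrow> gt v w"
proof -
  have "finite V" by simp
  then show ?thesis using assms
  proof (induction V rule: finite_ne_induct)
    case (insert x F)
    then obtain v where "v \<in> F" "\<forall>w\<in>F. w \<noteq> v \<longrightarrow> gt v w" by blast
    then show ?case using gt_total[of x v] gt_trans by (metis insert_iff)
  qed simp
qed

lemma lex_less_irrefl: "\<not> lex_less gt s s"
  by (simp add: lex_less_def)

lemma lex_less_trans:
  assumes "lex_less gt s t" "lex_less gt t u"
  shows "lex_less gt s u"
proof -
  obtain v where v: "Poly_Mapping.lookup s v < Poly_Mapping.lookup t v" "\<And>w. gt w v \<Longrightarrow> Poly_Mapping.lookup s w = Poly_Mapping.lookup t w"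
    using assms(1) by (auto simp: lex_less_def)
  obtain v' where v': "Poly_Mapping.lookup t v' < Poly_Mapping.lookup u v'" "\<And>w. gt w v' \<Longrightarrow> Poly_Mapping.lookup t w = Poly_Mapping.lookup u w"
    using assms(2) by (auto simp: lex_less_def)
  consider "v = v'" | "gt v v'" | "gt v' v" using gt_total by blast
  then show ?thesis
  proof cases
    case 1
    then show ?thesis unfolding lex_less_def using v v' by (metis less_trans)
  next
    case 2
    then show ?thesis unfolding lex_less_def using v v' by (metis gt_trans)
  next
    case 3
    then show ?thesis unfolding lex_less_def using v v' by (metis gt_trans)
  qed
qed

lemma lex_less_total:
  assumes "s \<noteq> t"
  shows "lex_less gt s t \<or> lex_less gt t s"
proof -
  have "{v. Poly_Mapping.lookup s v \<noteq> Poly_Mapping.lookup t v} \<noteq> {}"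
    using assms poly_mapping_eqI[of s t] by auto
  from ex_greatest[OF this] obtain v where v: "Poly_Mapping.lookup s v \<noteq> Poly_Mapping.lookup t v"
      "\<And>w. Poly_Mapping.lookup s w \<noteq> Poly_Mapping.lookup t w \<Longrightarrow> w \<noteq> v \<Longrightarrow> gt v w"
    by auto
  have "Poly_Mapping.lookup s w = Poly_Mapping.lookup t w" if "gt w v" for w
    using v(2)[of w] that gt_irrefl gt_trans by blast
  then show ?thesis
    using v(1) unfolding lex_less_def by (metis linorder_neqE_nat)
qed

lemma lex_less_add: "lex_less gt (u + s) (u + t) \<longleftrightarrow> lex_less gt s t"
  by (simp add: lex_less_def lookup_add)

text \<open>
  Minimising the exponents one variable at a time, from the greatest variable on, yields a
  lexicographically minimal element; the number of greater variables is the stage at which a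
  variable is treated.
\<close>

lemma wfp_lex_less: "wfp (lex_less gt)"
proof -
  define rank where "rank v = card {w. gt w v}" for v
  have rank_less: "rank w < rank v" if "gt w v" for v w
  proof -
    have "{u. gt u w} \<subset> {u. gt u v}"
      using that gt_trans gt_irrefl by blast
    then show ?thesis unfolding rank_def by (rule psubset_card_mono[OF finite])
  qed
  have stage: "\<exists>s\<in>Q. \<forall>t\<in>Q. \<forall>v. rank v < n \<longrightarrow>
      (\<forall>w. gt w v \<longrightarrow> Poly_Mapping.lookup t w = Poly_Mapping.lookup s w) \<longrightarrow> \<not> Poly_Mapping.lookup t v < Poly_Mapping.lookup s v"
    if "Q \<noteq> {}" for Q :: "('v \<Rightarrow>\<^sub>0 nat) set" and n
  proof (induction n)
    case 0
    then show ?case using that by auto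
  next
    case (Suc n)
    then obtain s where s: "s \<in> Q" "\<forall>t\<in>Q. \<forall>v. rank v < n \<longrightarrow>
      (\<forall>w. gt w v \<longrightarrow> Poly_Mapping.lookup t w = Poly_Mapping.lookup s w) \<longrightarrow> \<not> Poly_Mapping.lookup t v < Poly_Mapping.lookup s v" by blast
    show ?case
    proof (cases "\<exists>v. rank v = n")
      case False
      then show ?thesis using s by (metis less_antisym)
    next
      case True
      then obtain v where v: "rank v = n" by blast
      have uniq: "v' = v" if "rank v' = n" for v'
        using that v rank_less gt_total by (metis less_irrefl)
      define agree where "agree t \<longleftrightarrow> t \<in> Q \<and> (\<forall>w. gt w v \<longrightarrow> Poly_Mapping.lookup t w = Poly_Mapping.lookup s w)" for t
      have "agree s" using s by (simp add: agree_def)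
      then obtain s' where s': "agree s'" "\<And>t. agree t \<Longrightarrow> Poly_Mapping.lookup s' v \<le> Poly_Mapping.lookup t v"
        using ex_has_least_nat[of agree s "\<lambda>t. Poly_Mapping.lookup t v"] by blast
      have "\<not> Poly_Mapping.lookup t v' < Poly_Mapping.lookup s' v'"
        if t: "t \<in> Q" "rank v' < Suc n" "\<And>w. gt w v' \<Longrightarrow> Poly_Mapping.lookup t w = Poly_Mapping.lookup s' w" for t v'
      proof (cases "v' = v")
        case True
        then have "agree t" using t s'(1) by (simp add: agree_def)
        then show ?thesis using s'(2) True by (simp add: not_less)
      next
        case False
        then have lt: "rank v' < n" using uniq t(2) by (metis less_antisym)
        then have gt: "gt v' v" using gt_total[OF False] v rank_less[of v v'] by auto
        then have "Poly_Mapping.lookup t w = Poly_Mapping.lookup s w" if "gt w v'" for w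
          using that t(3) s'(1) gt_trans by (auto simp: agree_def)
        then show ?thesis using s(2) t(1) lt gt s'(1) by (auto simp: agree_def)
      qed
      then show ?thesis using s'(1) by (auto simp: agree_def)
    qed
  qed
  show ?thesis
  proof (unfold wfp_eq_minimal, intro allI impI)
    fix Q :: "('v \<Rightarrow>\<^sub>0 nat) set" and x
    assume "x \<in> Q"
    then have "Q \<noteq> {}" by auto
    from stage[OF this, of "Suc (Max (range rank))"] obtain s where
      s: "s \<in> Q" "\<And>t v. t \<in> Q \<Longrightarrow> (\<forall>w. gt w v \<longrightarrow> Poly_Mapping.lookup t w = Poly_Mapping.lookup s w) \<Longrightarrow>
        \<not> Poly_Mapping.lookup t v < Poly_Mapping.lookup s v"
      by (auto simp: less_Suc_eq_le)
    then show "\<exists>z\<in>Q. \<forall>y. lex_less gt y z \<longrightarrow> y \<notin> Q"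
      unfolding lex_less_def by blast
  qed
qed

lemma ex_lex_greatest:
  assumes "finite T" "T \<noteq> {}"
  shows "\<exists>t\<in>T. \<forall>s\<in>T. s \<noteq> t \<longrightarrow> lex_less gt s t"
  using assms
proof (induction T rule: finite_ne_induct)
  case (insert x F)
  then obtain v where "v \<in> F" "\<forall>w\<in>F. w \<noteq> v \<longrightarrow> lex_less gt w v" by blast
  then show ?case using lex_less_total[of x v] lex_less_trans by (metis insert_iff)
qed simp

definition leads :: "(('v \<Rightarrow>\<^sub>0 nat) \<Rightarrow>\<^sub>0 'k::field) \<Rightarrow> ('v \<Rightarrow>\<^sub>0 nat) \<Rightarrow> bool" where
  "leads p t \<longleftrightarrow> t \<in> Poly_Mapping.keys p \<and> (\<forall>s\<in>Poly_Mapping.keys p. s \<noteq> t \<longrightarrow> lex_less gt s t)"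

lemma leads_unique: "leads p s \<Longrightarrow> leads p t \<Longrightarrow> s = t"
  unfolding leads_def by (metis lex_less_irrefl lex_less_trans)

lemma leads_nonzero: "leads p t \<Longrightarrow> p \<noteq> 0"
  by (auto simp: leads_def)

end

lemma lookup_monomial_mult:
  fixes p :: "('v \<Rightarrow>\<^sub>0 nat) \<Rightarrow>\<^sub>0 'k::field"
  shows "Poly_Mapping.lookup (Poly_Mapping.single w c * p) (w + t) = c * Poly_Mapping.lookup p t"
proof -
  have "Poly_Mapping.lookup (Poly_Mapping.single w c * p) (w + t)
      = (\<Sum>l. Poly_Mapping.lookup (Poly_Mapping.single w c) l * (\<Sum>q. Poly_Mapping.lookup p q when w + t = l + q))"
    by (simp add: lookup_mult)
  also have "\<dots> = (\<Sum>l. (c * (\<Sum>q. Poly_Mapping.lookup p q when w + t = w + q)) when l = w)"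
    by (rule Sum_any.cong) (auto simp: lookup_single when_def)
  also have "\<dots> = c * (\<Sum>q. Poly_Mapping.lookup p q when w + t = w + q)" by simp
  also have "(\<Sum>q. Poly_Mapping.lookup p q when w + t = w + q) = Poly_Mapping.lookup p t"
    by (simp add: add_left_cancel)
  finally show ?thesis .
qed

lemma keys_monomial_mult:
  fixes p :: "('v \<Rightarrow>\<^sub>0 nat) \<Rightarrow>\<^sub>0 'k::field"
  shows "Poly_Mapping.keys (Poly_Mapping.single w c * p) \<subseteq> (+) w ` Poly_Mapping.keys p"
  using keys_mult[of "Poly_Mapping.single w c" p] by (auto split: if_splits)

lemma (in variable_order) leads_monomial_mult:
  fixes p :: "('v \<Rightarrow>\<^sub>0 nat) \<Rightarrow>\<^sub>0 'k::field"
  assumes "leads p t" "c \<noteq> 0"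
  shows "leads (Poly_Mapping.single w c * p) (w + t)"
proof -
  have "w + t \<in> Poly_Mapping.keys (Poly_Mapping.single w c * p)"
    using assms by (simp add: leads_def in_keys_iff lookup_monomial_mult)
  moreover have "lex_less gt s (w + t)"
    if "s \<in> Poly_Mapping.keys (Poly_Mapping.single w c * p)" "s \<noteq> w + t" for s
    using subsetD[OF keys_monomial_mult that(1)] that(2) assms(1)
    by (auto simp: leads_def lex_less_add)
  ultimately show ?thesis by (auto simp: leads_def)
qed

section \<open>Groebner bases of sums of ideals\<close>

interpretation ring_module: Modules.module "(*) :: 'a::comm_ring_1 \<Rightarrow> 'a \<Rightarrow> 'a"
  by unfold_locales (simp_all add: algebra_simps)

lemma ideal_gen_Union_sum:
  fixes G :: "nat \<Rightarrow> ('m, 'n, 'k::field) mpoly set"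
  assumes "finite K" "p \<in> ideal_gen (\<Union>i\<in>K. G i)"
  shows "\<exists>f. (\<forall>i\<in>K. f i \<in> ideal_gen (G i)) \<and> p = (\<Sum>i\<in>K. f i)"
proof -
  let ?S = "{(\<Sum>i\<in>K. f i) | f. \<forall>i\<in>K. f i \<in> ideal_gen (G i)}"
  have gen: "(\<Union>i\<in>K. G i) \<subseteq> ?S"
  proof
    fix g assume "g \<in> (\<Union>i\<in>K. G i)"
    then obtain i where i: "i \<in> K" "g \<in> G i" by blast
    define f where "f j = (if j = i then g else 0)" for j
    have "(\<Sum>j\<in>K. f j) = g" using i assms(1) by (simp add: f_def)
    moreover have "\<forall>j\<in>K. f j \<in> ideal_gen (G j)"
      using i by (auto simp: f_def ideal_gen_def ring_module.span_base ring_module.span_zero)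
    ultimately show "g \<in> ?S" by blast
  qed
  have "ring_module.subspace ?S"
  proof (rule ring_module.subspaceI)
    show "0 \<in> ?S"
      by (rule CollectI, rule exI[of _ "\<lambda>_. 0"]) (simp add: ideal_gen_def ring_module.span_zero)
  next
    fix x y assume "x \<in> ?S" "y \<in> ?S"
    then obtain f g where
      fg: "\<forall>i\<in>K. f i \<in> ideal_gen (G i)" "x = (\<Sum>i\<in>K. f i)"
        "\<forall>i\<in>K. g i \<in> ideal_gen (G i)" "y = (\<Sum>i\<in>K. g i)" by blast
    have "x + y = (\<Sum>i\<in>K. f i + g i)" using fg by (simp add: sum.distrib)
    moreover have "\<forall>i\<in>K. f i + g i \<in> ideal_gen (G i)"
      using fg by (auto simp: ideal_gen_def ring_module.span_add)
    ultimately show "x + y \<in> ?S"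
      by (intro CollectI exI[of _ "\<lambda>i. f i + g i"]) simp
  next
    fix c x assume "x \<in> ?S"
    then obtain f where f: "\<forall>i\<in>K. f i \<in> ideal_gen (G i)" "x = (\<Sum>i\<in>K. f i)" by blast
    have "c * x = (\<Sum>i\<in>K. c * f i)" using f by (simp add: sum_distrib_left)
    moreover have "\<forall>i\<in>K. c * f i \<in> ideal_gen (G i)"
      using f by (auto simp: ideal_gen_def intro: ring_module.span_scale)
    ultimately show "c * x \<in> ?S"
      by (intro CollectI exI[of _ "\<lambda>i. c * f i"]) simp
  qed
  from ring_module.span_minimal[OF gen this] assms(2) show ?thesis
    unfolding ideal_gen_def by blast
qed

text \<open>
  The polynomials all of whose monomials are multiples of elements of \<open>T\<close> form an ideal, so
  membership in a monomial ideal is decided monomial by monomial.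
\<close>

lemma keys_monomial_ideal:
  fixes T :: "('m \<times> 'n \<Rightarrow>\<^sub>0 nat) set"
  assumes "(p :: ('m, 'n, 'k::field) mpoly) \<in> ideal_gen (power_product ` T)"
    and "t \<in> Poly_Mapping.keys p"
  shows "\<exists>s\<in>T. \<exists>w. t = w + s"
proof -
  let ?S = "{p :: ('m, 'n, 'k) mpoly. \<forall>t\<in>Poly_Mapping.keys p. \<exists>s\<in>T. \<exists>w. t = w + s}"
  have "ring_module.subspace ?S"
  proof (rule ring_module.subspaceI)
    fix x y assume "x \<in> ?S" "y \<in> ?S"
    then show "x + y \<in> ?S" using Poly_Mapping.keys_add[of x y] by blast
  next
    fix c x assume x: "x \<in> ?S"
    show "c * x \<in> ?S"
    proof safe
      fix t assume "t \<in> Poly_Mapping.keys (c * x)"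
      then obtain a b where "t = a + b" "b \<in> Poly_Mapping.keys x"
        using keys_mult[of c x] by blast
      moreover from this(2) x obtain s w where "s \<in> T" "b = w + s" by blast
      ultimately have "t = (a + w) + s" by (simp add: add.assoc)
      then show "\<exists>s\<in>T. \<exists>w. t = w + s" using \<open>s \<in> T\<close> by blast
    qed
  qed simp
  moreover have "power_product ` T \<subseteq> ?S"
    by (auto simp: power_product_def intro!: exI[of _ 0])
  ultimately have "ideal_gen (power_product ` T) \<subseteq> ?S"
    unfolding ideal_gen_def by (rule ring_module.span_minimal[rotated])
  then show ?thesis using assms by blast
qed

lemma lead_ideal_mono: "S \<subseteq> T \<Longrightarrow> lead_ideal gt S \<subseteq> lead_ideal gt T"
  unfolding lead_ideal_def ideal_gen_def by (rule ring_module.span_mono) blast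

lemma lead_exponent_eq:
  assumes "variable_order gt" "variable_order.leads gt p t"
  shows "lead_exponent gt p = t"
  unfolding lead_exponent_def
  using assms variable_order.leads_unique[OF assms(1), of p]
  by (intro the_equality) (auto simp: variable_order.leads_def[OF assms(1)])

lemma power_product_in_lead_ideal:
  fixes p :: "('m::finite, 'n::finite, 'k::field) mpoly"
  assumes "variable_order gt" "p \<in> S" "variable_order.leads gt p t"
  shows "power_product t \<in> (lead_ideal gt S :: ('m, 'n, 'k) mpoly set)"
proof -
  have "power_product t \<in> {power_product (lead_exponent gt p) | p. p \<in> S \<and> p \<noteq> 0}"
    using assms variable_order.leads_nonzero[OF assms(1,3)] lead_exponent_eq[OF assms(1,3)] by blast
  then show ?thesis
    unfolding lead_ideal_def ideal_gen_def by (rule ring_module.span_base)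
qed

text \<open>
  Let \<open>t\<close> bound all monomials of the summands. If \<open>t\<close> survives in the sum, then it is the leading
  monomial of the sum and of every summand containing it. If it cancels, the summands containing
  \<open>t\<close> have leading monomial \<open>t\<close>, and by \<open>common\<close> multiples of elements of \<open>I i \<inter> I j\<close> can be taken
  out of the \<open>i\<close>-th summand and put into the \<open>j\<close>-th one: the sum and the memberships are kept, and
  the bound drops. This stops since the lexicographic order is well-founded.
\<close>

lemma lead_of_sum_of_ideals:
  fixes gt :: "'m::finite \<times> 'n::finite \<Rightarrow> 'm \<times> 'n \<Rightarrow> bool"
    and I :: "nat \<Rightarrow> ('m, 'n, 'k::field) mpoly set"
  assumes "variable_order gt" and "finite K"
    and sub: "\<And>i. i \<in> K \<Longrightarrow> ring_module.subspace (I i)"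
    and common: "\<And>i j p q t. \<lbrakk>i \<in> K; j \<in> K; i \<noteq> j; p \<in> I i; q \<in> I j;
        variable_order.leads gt p t; variable_order.leads gt q t\<rbrakk> \<Longrightarrow>
        \<exists>h\<in>I i \<inter> I j. variable_order.leads gt h t"
    and "\<forall>i\<in>K. f i \<in> I i" and "(\<Sum>i\<in>K. f i) \<noteq> 0"
  shows "\<exists>i\<in>K. \<exists>g\<in>I i. \<exists>t. variable_order.leads gt (\<Sum>i\<in>K. f i) t \<and> variable_order.leads gt g t"
proof -
  interpret variable_order gt by fact
  define bounded where
    "bounded p t \<longleftrightarrow> (\<forall>s\<in>Poly_Mapping.keys p. s = t \<or> lex_less gt s t)" for p :: "('m, 'n, 'k) mpoly" and t
  have bounded_add: "bounded (p + q) t" if "bounded p t" "bounded q t" for p q t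
    using that Poly_Mapping.keys_add[of p q] unfolding bounded_def by blast
  have bounded_sum: "bounded (sum p A) t" if "\<And>i. i \<in> A \<Longrightarrow> bounded (p i) t" for p t and A :: "nat set"
    using that
  proof (induction A rule: infinite_finite_induct)
    case (insert i A)
    then show ?case by (simp add: bounded_add)
  qed (simp_all add: bounded_def)
  have main: "\<exists>i\<in>K. \<exists>g\<in>I i. \<exists>u. leads (\<Sum>i\<in>K. f i) u \<and> leads g u"
    if "\<forall>i\<in>K. f i \<in> I i \<and> bounded (f i) t" "(\<Sum>i\<in>K. f i) \<noteq> 0" for f t
    using that
  proof (induction t arbitrary: f rule: wfp_induct_rule[OF wfp_lex_less])
    case (1 t)
    have bdd: "bounded (f i) t" and mem: "f i \<in> I i" if "i \<in> K" for i using 1(2) that by auto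
    let ?c = "\<lambda>i. Poly_Mapping.lookup (f i) t"
    have leads_f: "leads (f i) t" if "i \<in> K" "?c i \<noteq> 0" for i
      using that bdd[OF that(1)] by (auto simp: leads_def bounded_def in_keys_iff)
    show ?case
    proof (cases "(\<Sum>i\<in>K. ?c i) = 0")
      case False
      then obtain i where i: "i \<in> K" "?c i \<noteq> 0" by (meson sum.not_neutral_contains_not_neutral)
      have "Poly_Mapping.lookup (\<Sum>i\<in>K. f i) t \<noteq> 0" using False by (simp add: lookup_sum)
      moreover have "bounded (\<Sum>i\<in>K. f i) t" using bdd by (intro bounded_sum)
      ultimately have "leads (\<Sum>i\<in>K. f i) t"
        by (auto simp: leads_def bounded_def in_keys_iff)
      then show ?thesis using i mem leads_f by blast
    next
      case True
      \<comment> \<open>All terms at \<open>t\<close> are moved into one summand \<open>j\<close>, where they cancel because their sum is zero.\<close>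
      have "\<exists>f'. (\<forall>i\<in>K. f' i \<in> I i \<and> bounded (f' i) t \<and> Poly_Mapping.lookup (f' i) t = 0) \<and>
          (\<Sum>i\<in>K. f' i) = (\<Sum>i\<in>K. f i)"
      proof (cases "\<exists>j\<in>K. ?c j \<noteq> 0")
        case False
        then show ?thesis using bdd mem by (intro exI[of _ f]) auto
      next
        case True': True
        then obtain j where j: "j \<in> K" "?c j \<noteq> 0" by blast
        have "\<exists>h\<in>I i \<inter> I j. bounded h t \<and> Poly_Mapping.lookup h t = ?c i"
          if i: "i \<in> K - {j}" for i
        proof (cases "?c i = 0")
          case True
          then show ?thesis using sub i j
            by (intro bexI[of _ 0]) (auto simp: bounded_def ring_module.subspace_0)
        next
          case False
          then obtain h where h: "h \<in> I i \<inter> I j" "leads h t"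
            using common[of i j "f i" "f j" t] i j mem leads_f by auto
          let ?d = "?c i / Poly_Mapping.lookup h t"
          let ?h = "Poly_Mapping.single 0 ?d * h"
          have nz: "Poly_Mapping.lookup h t \<noteq> 0" using h(2) by (simp add: leads_def in_keys_iff)
          then have "leads ?h (0 + t)" using h(2) False by (intro leads_monomial_mult) auto
          then have "bounded ?h t" by (auto simp: leads_def bounded_def)
          moreover have "Poly_Mapping.lookup ?h t = ?c i"
            using lookup_monomial_mult[of 0 ?d h t] nz by simp
          moreover have "?h \<in> I i \<inter> I j"
            using h(1) i j sub by (auto intro!: ring_module.subspace_scale)
          ultimately show ?thesis by blast
        qed
        then obtain h where h: "\<And>i. i \<in> K - {j} \<Longrightarrow>
            h i \<in> I i \<inter> I j \<and> bounded (h i) t \<and> Poly_Mapping.lookup (h i) t = ?c i" by metis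
        define f' where "f' i = (if i = j then f j + (\<Sum>i\<in>K - {j}. h i) else f i - h i)" for i
        have "(\<Sum>i\<in>K. f' i) = f' j + (\<Sum>i\<in>K - {j}. f' i)"
          using j assms(2) by (simp add: sum.remove)
        also have "(\<Sum>i\<in>K - {j}. f' i) = (\<Sum>i\<in>K - {j}. f i - h i)"
          by (rule sum.cong) (auto simp: f'_def)
        also have "f' j + \<dots> = f j + (\<Sum>i\<in>K - {j}. f i)"
          by (simp add: f'_def sum_subtractf)
        also have "\<dots> = (\<Sum>i\<in>K. f i)" using j assms(2) by (simp add: sum.remove)
        finally have sum_eq: "(\<Sum>i\<in>K. f' i) = (\<Sum>i\<in>K. f i)" .
        have "f' i \<in> I i \<and> bounded (f' i) t \<and> Poly_Mapping.lookup (f' i) t = 0" if i: "i \<in> K" for i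
        proof (cases "i = j")
          case True
          have "(\<Sum>i\<in>K - {j}. h i) \<in> I j"
            using h sub[OF j(1)] by (intro ring_module.subspace_sum) auto
          moreover have "bounded (\<Sum>i\<in>K - {j}. h i) t" using h by (intro bounded_sum) auto
          moreover have "Poly_Mapping.lookup (f' j) t = ?c j + (\<Sum>i\<in>K - {j}. ?c i)"
            using h by (simp add: f'_def lookup_add lookup_sum)
          moreover have "\<dots> = 0"
            using \<open>(\<Sum>i\<in>K. ?c i) = 0\<close> j assms(2) by (simp add: sum.remove)
          ultimately show ?thesis
            using True mem[OF j(1)] bdd[OF j(1)] sub[OF j(1)]
            by (auto simp: f'_def intro: bounded_add ring_module.subspace_add)
        next
          case False
          then have hi: "h i \<in> I i" "bounded (h i) t" "Poly_Mapping.lookup (h i) t = ?c i"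
            using h i by auto
          have "bounded (f i - h i) t"
            using Poly_Mapping.keys_diff[of "f i" "h i"] hi(2) bdd[OF i] unfolding bounded_def by blast
          then show ?thesis
            using False hi mem[OF i] sub[OF i]
            by (auto simp: f'_def lookup_minus intro: ring_module.subspace_diff)
        qed
        then show ?thesis using sum_eq by blast
      qed
      then obtain f' where f': "\<And>i. i \<in> K \<Longrightarrow> f' i \<in> I i" "\<And>i. i \<in> K \<Longrightarrow> bounded (f' i) t"
          "\<And>i. i \<in> K \<Longrightarrow> Poly_Mapping.lookup (f' i) t = 0" and sum_eq: "(\<Sum>i\<in>K. f' i) = (\<Sum>i\<in>K. f i)"
        by blast
      let ?T = "\<Union>i\<in>K. Poly_Mapping.keys (f' i)"
      have "?T \<noteq> {}"
      proof
        assume "?T = {}"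
        then have "f' i = 0" if "i \<in> K" for i using that by auto
        then have "(\<Sum>i\<in>K. f' i) = 0" by simp
        then show False using 1(3) sum_eq by simp
      qed
      then obtain u where u: "u \<in> ?T" "\<forall>s\<in>?T. s \<noteq> u \<longrightarrow> lex_less gt s u"
        using ex_lex_greatest[of ?T] assms(2) by auto
      then obtain i where i: "i \<in> K" "u \<in> Poly_Mapping.keys (f' i)" by blast
      then have "u \<noteq> t" using f'(3)[OF i(1)] by (auto simp: in_keys_iff)
      then have "lex_less gt u t" using f'(2)[OF i(1)] i(2) by (auto simp: bounded_def)
      moreover have "\<forall>i\<in>K. f' i \<in> I i \<and> bounded (f' i) u" using u f'(1) by (auto simp: bounded_def)
      ultimately show ?thesis using "1.IH"[of u f'] 1(3) sum_eq by simp
    qed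
  qed
  let ?T = "\<Union>i\<in>K. Poly_Mapping.keys (f i)"
  have "?T \<noteq> {}"
  proof
    assume "?T = {}"
    then have "f i = 0" if "i \<in> K" for i using that by auto
    then show False using assms(6) by simp
  qed
  then obtain u where u: "u \<in> ?T" "\<forall>s\<in>?T. s \<noteq> u \<longrightarrow> lex_less gt s u"
    using ex_lex_greatest[of ?T] assms(2) by auto
  then have "\<forall>i\<in>K. f i \<in> I i \<and> bounded (f i) u" using assms(5) by (auto simp: bounded_def)
  then show ?thesis using assms(6) by (rule main)
qed

lemma leads_divisible:
  fixes gt :: "'m::finite \<times> 'n::finite \<Rightarrow> 'm \<times> 'n \<Rightarrow> bool"
  assumes "variable_order gt" "groebner_basis gt G I"
    and "p \<in> I" "variable_order.leads gt p t"
  shows "\<exists>g\<in>G. \<exists>w. g \<noteq> (0 :: ('m, 'n, 'k::field) mpoly) \<and> t = w + lead_exponent gt g"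
proof -
  interpret variable_order gt by fact
  have "power_product t \<in> (lead_ideal gt I :: ('m, 'n, 'k) mpoly set)"
    by (rule power_product_in_lead_ideal[OF assms(1,3,4)])
  also have "lead_ideal gt I = lead_ideal gt G"
    using assms(2) by (simp add: groebner_basis_def)
  also have "\<dots> = ideal_gen (power_product ` {lead_exponent gt g | g. g \<in> G \<and> g \<noteq> 0})"
    unfolding lead_ideal_def by (rule arg_cong[where f = ideal_gen]) auto
  finally show ?thesis
    using keys_monomial_ideal[of "power_product t"
        "{lead_exponent gt g | g. g \<in> G \<and> g \<noteq> 0}" t]
    by (auto simp: power_product_def)
qed

text \<open>
  The S-polynomial of \<open>g\<close> and \<open>g'\<close> is a difference \<open>m * g - m' * g'\<close> of multiples that share the
  least common multiple \<open>L\<close> of the two leading monomials. A common element \<open>h\<close> of the two ideals with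
  leading coefficient one and leading monomial \<open>L\<close> splits it as \<open>(m * g - h) - (m' * g' - h)\<close>, where
  each part is smaller and lies in an ideal for which a Groebner basis is known. The same exchange is
  carried out directly on representations of elements of the sum: if \<open>g\<close> and \<open>g'\<close> account for a
  common leading monomial \<open>t\<close>, then \<open>L\<close> divides \<open>t\<close>, and a monomial multiple of \<open>h\<close> has leading
  monomial \<open>t\<close>. For this the leading monomial of \<open>h\<close> need only divide \<open>L\<close>, whose exponents are the
  maxima in \<open>common\<close>.
\<close>

lemma groebner_basis_Union:
  fixes gt :: "'m::finite \<times> 'n::finite \<Rightarrow> 'm \<times> 'n \<Rightarrow> bool"
    and G :: "nat \<Rightarrow> ('m, 'n, 'k::field) mpoly set"
  assumes gt: "variable_order gt" and fin: "finite K"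
    and gb: "\<And>i. i \<in> K \<Longrightarrow> groebner_basis gt (G i) (ideal_gen (G i))"
    and common: "\<And>i j g g'. \<lbrakk>i \<in> K; j \<in> K; i \<noteq> j; g \<in> G i; g' \<in> G j; g \<noteq> 0; g' \<noteq> 0\<rbrakk> \<Longrightarrow>
        \<exists>h\<in>ideal_gen (G i) \<inter> ideal_gen (G j). \<exists>s. variable_order.leads gt h s \<and>
          (\<forall>v. Poly_Mapping.lookup s v
            \<le> max (Poly_Mapping.lookup (lead_exponent gt g) v) (Poly_Mapping.lookup (lead_exponent gt g') v))"
  shows "groebner_basis gt (\<Union>i\<in>K. G i) (ideal_gen (\<Union>i\<in>K. G i))"
proof -
  interpret variable_order gt by fact
  let ?I = "\<lambda>i. ideal_gen (G i)"
  have common_lead: "\<exists>h\<in>?I i \<inter> ?I j. leads h t"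
    if ij: "i \<in> K" "j \<in> K" "i \<noteq> j" and pq: "p \<in> ?I i" "q \<in> ?I j" "leads p t" "leads q t" for i j p q t
  proof -
    obtain g w where g: "g \<in> G i" "g \<noteq> 0" "t = w + lead_exponent gt g"
      using leads_divisible[OF gt gb[OF ij(1)] pq(1,3)] by blast
    obtain g' w' where g': "g' \<in> G j" "g' \<noteq> 0" "t = w' + lead_exponent gt g'"
      using leads_divisible[OF gt gb[OF ij(2)] pq(2,4)] by blast
    obtain h s where h: "h \<in> ?I i \<inter> ?I j" "leads h s" and
      le: "\<And>v. Poly_Mapping.lookup s v
            \<le> max (Poly_Mapping.lookup (lead_exponent gt g) v) (Poly_Mapping.lookup (lead_exponent gt g') v)"
      using common[OF ij g(1) g'(1) g(2) g'(2)] by blast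
    have "Poly_Mapping.lookup s v \<le> Poly_Mapping.lookup t v" for v
    proof -
      have "Poly_Mapping.lookup (lead_exponent gt g) v \<le> Poly_Mapping.lookup t v"
        using g(3) by (simp add: lookup_add)
      moreover have "Poly_Mapping.lookup (lead_exponent gt g') v \<le> Poly_Mapping.lookup t v"
        using g'(3) by (simp add: lookup_add)
      ultimately show ?thesis using le[of v] by simp
    qed
    then have t: "t = (t - s) + s"
      by (intro poly_mapping_eqI) (simp add: lookup_add lookup_minus)
    then have "leads (Poly_Mapping.single (t - s) 1 * h) t"
      using leads_monomial_mult[OF h(2), of 1 "t - s"] by simp
    moreover have "Poly_Mapping.single (t - s) 1 * h \<in> ?I i \<inter> ?I j"
      using h(1) by (auto simp: ideal_gen_def intro: ring_module.span_scale)
    ultimately show ?thesis by blast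
  qed
  have "{power_product (lead_exponent gt p) | p. p \<in> ideal_gen (\<Union>i\<in>K. G i) \<and> p \<noteq> 0}
      \<subseteq> lead_ideal gt (\<Union>i\<in>K. G i)"
  proof clarify
    fix p :: "('m, 'n, 'k) mpoly" assume p: "p \<in> ideal_gen (\<Union>i\<in>K. G i)" "p \<noteq> 0"
    obtain f where f: "\<forall>i\<in>K. f i \<in> ?I i" "p = (\<Sum>i\<in>K. f i)"
      using ideal_gen_Union_sum[OF fin p(1)] by blast
    have sub: "ring_module.subspace (?I i)" for i by (simp add: ideal_gen_def)
    have nz: "(\<Sum>i\<in>K. f i) \<noteq> 0" using p f by simp
    have "\<exists>i\<in>K. \<exists>g\<in>?I i. \<exists>t. leads (\<Sum>i\<in>K. f i) t \<and> leads g t"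
      by (rule lead_of_sum_of_ideals[OF gt fin, of ?I, OF sub _ f(1) nz]) (rule common_lead)
    then obtain i g t where i: "i \<in> K" "g \<in> ?I i" "leads p t" "leads g t"
      using f(2) by blast
    then have "power_product (lead_exponent gt p) \<in> lead_ideal gt (?I i)"
      using power_product_in_lead_ideal[OF gt, of g "?I i" t] lead_exponent_eq[OF gt, of p t] by simp
    also have "\<dots> = lead_ideal gt (G i)" using gb[OF i(1)] by (simp add: groebner_basis_def)
    also have "\<dots> \<subseteq> lead_ideal gt (\<Union>i\<in>K. G i)" using i(1) by (intro lead_ideal_mono) blast
    finally show "power_product (lead_exponent gt p) \<in> lead_ideal gt (\<Union>i\<in>K. G i)" .
  qed
  then have "lead_ideal gt (ideal_gen (\<Union>i\<in>K. G i)) \<subseteq> lead_ideal gt (\<Union>i\<in>K. G i)"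
    unfolding lead_ideal_def ideal_gen_def
    by (intro ring_module.span_minimal) auto
  moreover have sup: "(\<Union>i\<in>K. G i) \<subseteq> ideal_gen (\<Union>i\<in>K. G i)"
    unfolding ideal_gen_def by (rule ring_module.span_superset)
  moreover have "finite (\<Union>i\<in>K. G i)"
    using fin gb by (auto simp: groebner_basis_def)
  ultimately show ?thesis
    using lead_ideal_mono[OF sup, of gt] by (auto simp: groebner_basis_def)
qed

section \<open>Determinants in ideals of minors\<close>

text \<open>
  Laplace expansion along the columns outside \<open>S\<close>, one after the other: what remains in the end
  are determinants with all columns from \<open>S\<close>. Only the columns in \<open>S\<close> have to consist of
  prescribed entries. Rows may repeat, so minors with arbitrary index functions are needed in the
  hypothesis.
\<close>

lemma det_mem_of_column_minors:
  fixes e :: "'a \<Rightarrow> 'b \<Rightarrow> 'c::comm_ring_1"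
  assumes "ring_module.subspace J"
    and minors: "\<And>\<rho> \<gamma>. (\<forall>i<r. \<rho> i \<in> A) \<Longrightarrow> (\<forall>j<r. \<gamma> j \<in> C) \<Longrightarrow>
        det (mat r r (\<lambda>(i, j). e (\<rho> i) (\<gamma> j))) \<in> J"
    and "N \<in> carrier_mat n n" "S \<subseteq> {0..<n}" "card S = r"
    and "\<forall>i<n. \<rho> i \<in> A" "\<forall>j\<in>S. \<gamma> j \<in> C" "\<forall>i<n. \<forall>j\<in>S. N $$ (i, j) = e (\<rho> i) (\<gamma> j)"
  shows "det N \<in> J"
  using assms(3-)
proof (induction n arbitrary: N S \<rho> \<gamma>)
  case 0
  then have "N = mat r r (\<lambda>(i, j). e (\<rho> i) (\<gamma> j))" by (intro eq_matI) auto
  then show ?case using minors[of \<rho> \<gamma>] 0 by auto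
next
  case (Suc n)
  show ?case
  proof (cases "S = {0..<Suc n}")
    case True
    then have r: "r = Suc n" using Suc.prems(3) by simp
    then have "N = mat r r (\<lambda>(i, j). e (\<rho> i) (\<gamma> j))"
      using Suc.prems True by (intro eq_matI) auto
    then show ?thesis using minors[of \<rho> \<gamma>] Suc.prems r True by auto
  next
    case False
    then have "S \<subset> {0..<Suc n}" using Suc.prems(2) by (rule psubsetI[rotated])
    then obtain k where "k \<in> {0..<Suc n} - S" using psubset_imp_ex_mem by blast
    then have k: "k < Suc n" "k \<notin> S" by simp_all
    define S' where "S' = {j\<in>{0..<n}. insert_index k j \<in> S}"
    have "insert_index k ` S' = S"
    proof (intro equalityI subsetI)
      fix j assume j: "j \<in> S"
      then have "j \<noteq> k" using k(2) by blast
      then have "j \<in> insert_index k ` {0..<n}"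
        unfolding insert_index_image[OF k(1)] using j Suc.prems(2) by blast
      then obtain j' where "j' \<in> {0..<n}" "j = insert_index k j'" by blast
      then show "j \<in> insert_index k ` S'" using j by (auto simp: S'_def)
    qed (auto simp: S'_def)
    then have S': "card S' = r"
      using card_image[OF insert_index_inj_on, of k S'] Suc.prems(3) by simp
    have "det (mat_delete N i k) \<in> J" if i: "i < Suc n" for i
    proof (rule Suc.IH[of _ S' "\<rho> \<circ> insert_index i" "\<gamma> \<circ> insert_index k"])
      show "mat_delete N i k \<in> carrier_mat n n"
        using mat_delete_carrier[OF Suc.prems(1)] by simp
      show "\<forall>i'<n. \<forall>j\<in>S'. mat_delete N i k $$ (i', j)
          = e ((\<rho> \<circ> insert_index i) i') ((\<gamma> \<circ> insert_index k) j)"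
      proof (intro allI impI ballI)
        fix i' j assume ij: "i' < n" "j \<in> S'"
        then have "mat_delete N i k $$ (i', j) = N $$ (insert_index i i', insert_index k j)"
          using mat_delete_index[OF Suc.prems(1) i k(1)] by (simp add: S'_def)
        moreover have "insert_index i i' < Suc n" using ij(1) by (simp add: insert_index_def)
        ultimately show "mat_delete N i k $$ (i', j)
            = e ((\<rho> \<circ> insert_index i) i') ((\<gamma> \<circ> insert_index k) j)"
          using Suc.prems(6) ij(2) by (simp add: S'_def)
      qed
    qed (use S' Suc.prems in \<open>auto simp: S'_def insert_index_def\<close>)
    then have "N $$ (i, k) * cofactor N i k \<in> J" if "i < Suc n" for i
      using that assms(1) unfolding cofactor_def by (intro ring_module.subspace_scale) auto
    then show ?thesis
      unfolding laplace_expansion_column[OF Suc.prems(1) k(1)]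
      by (intro ring_module.subspace_sum assms(1)) auto
  qed
qed

lemma det_mem_of_row_minors:
  fixes e :: "'a \<Rightarrow> 'b \<Rightarrow> 'c::comm_ring_1"
  assumes "ring_module.subspace J"
    and minors: "\<And>\<rho> \<gamma>. (\<forall>i<r. \<rho> i \<in> A) \<Longrightarrow> (\<forall>j<r. \<gamma> j \<in> C) \<Longrightarrow>
        det (mat r r (\<lambda>(i, j). e (\<rho> i) (\<gamma> j))) \<in> J"
    and N: "N \<in> carrier_mat n n" "S \<subseteq> {0..<n}" "card S = r"
    and "\<forall>i\<in>S. \<rho> i \<in> A" "\<forall>j<n. \<gamma> j \<in> C" "\<forall>i\<in>S. \<forall>j<n. N $$ (i, j) = e (\<rho> i) (\<gamma> j)"
  shows "det N \<in> J"
proof -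
  have "det (transpose_mat N) \<in> J"
  proof (rule det_mem_of_column_minors[where e = "\<lambda>j i. e i j" and A = C and C = A and S = S
        and \<rho> = \<gamma> and \<gamma> = \<rho> and r = r, OF assms(1)])
    fix \<rho> :: "nat \<Rightarrow> 'b" and \<gamma> :: "nat \<Rightarrow> 'a"
    assume \<rho>\<gamma>: "\<forall>i<r. \<rho> i \<in> C" "\<forall>j<r. \<gamma> j \<in> A"
    have "mat r r (\<lambda>(i, j). e (\<gamma> j) (\<rho> i)) = transpose_mat (mat r r (\<lambda>(i, j). e (\<gamma> i) (\<rho> j)))"
      by (intro eq_matI) auto
    then have "det (mat r r (\<lambda>(i, j). e (\<gamma> j) (\<rho> i))) = det (mat r r (\<lambda>(i, j). e (\<gamma> i) (\<rho> j)))"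
      using det_transpose[of "mat r r (\<lambda>(i, j). e (\<gamma> i) (\<rho> j))" r] by simp
    then show "det (mat r r (\<lambda>(i, j). e (\<gamma> j) (\<rho> i))) \<in> J" using minors \<rho>\<gamma> by simp
  next
    show "\<forall>i<n. \<forall>j\<in>S. transpose_mat N $$ (i, j) = e (\<rho> j) (\<gamma> i)"
      using N(1,2) assms(8) by (auto simp: subset_eq)
  qed (use assms in auto)
  then show ?thesis using det_transpose[OF N(1)] by simp
qed

lemma ex_sorting_permutation:
  fixes \<rho> :: "nat \<Rightarrow> 'a::linorder"
  assumes "inj_on \<rho> {0..<r}"
  shows "\<exists>p. p permutes {0..<r} \<and> (\<forall>i<r. \<rho> i = sorted_list_of_set (\<rho> ` {0..<r}) ! p i)"
proof -
  let ?L = "sorted_list_of_set (\<rho> ` {0..<r})"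
  have L: "length ?L = r" using card_image[OF assms] by simp
  have bij: "bij_betw ((!) ?L) {0..<r} (\<rho> ` {0..<r})"
    using bij_betw_nth[of ?L "{0..<r}" "\<rho> ` {0..<r}"] L by (simp add: atLeast0LessThan)
  define p where "p i = (if i < r then inv_into {0..<r} ((!) ?L) (\<rho> i) else i)" for i
  have "bij_betw (inv_into {0..<r} ((!) ?L) \<circ> \<rho>) {0..<r} {0..<r}"
    using bij_betw_trans[OF inj_on_imp_bij_betw[OF assms] bij_betw_inv_into[OF bij]] .
  then have "bij_betw p {0..<r} {0..<r}"
    by (rule bij_betw_cong[THEN iffD1, rotated]) (simp add: p_def)
  then have "p permutes {0..<r}" by (rule bij_imp_permutes) (simp add: p_def)
  moreover have "\<rho> i = ?L ! p i" if "i < r" for i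
    using bij_betw_inv_into_right[OF bij, of "\<rho> i"] that by (simp add: p_def)
  ultimately show ?thesis by blast
qed

lemma det_rows_of_set:
  fixes e :: "'a::linorder \<Rightarrow> nat \<Rightarrow> 'c::comm_ring_1"
  assumes "inj_on \<rho> {0..<r}"
  shows "\<exists>c. det (mat r r (\<lambda>(i, j). e (\<rho> i) j))
    = c * det (mat r r (\<lambda>(i, j). e (sorted_list_of_set (\<rho> ` {0..<r}) ! i) j))"
proof -
  obtain p where p: "p permutes {0..<r}"
      "\<And>i. i < r \<Longrightarrow> \<rho> i = sorted_list_of_set (\<rho> ` {0..<r}) ! p i"
    using ex_sorting_permutation[OF assms] by blast
  let ?N = "mat r r (\<lambda>(i, j). e (sorted_list_of_set (\<rho> ` {0..<r}) ! i) j)"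
  have "p i < r" if "i < r" for i
    using permutes_in_image[OF p(1), of i] that by simp
  then have "mat r r (\<lambda>(i, j). e (\<rho> i) j) = mat r r (\<lambda>(i, j). ?N $$ (p i, j))"
    by (intro eq_matI) (simp_all add: p(2)[symmetric])
  then show ?thesis using det_permute_rows[of ?N r p] p(1) by auto
qed

lemma det_zero_of_repeated_row_index:
  fixes e :: "'a \<Rightarrow> nat \<Rightarrow> 'c::comm_ring_1"
  assumes "\<not> inj_on \<rho> {0..<r}"
  shows "det (mat r r (\<lambda>(i, j). e (\<rho> i) j)) = 0"
proof -
  obtain i i' where i: "i < r" "i' < r" "i \<noteq> i'" "\<rho> i = \<rho> i'"
    using assms by (auto simp: inj_on_def)
  let ?N = "mat r r (\<lambda>(i, j). e (\<rho> i) j)"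
  have "row ?N i = row ?N i'" using i by (intro eq_vecI) auto
  then show ?thesis using det_identical_rows[of ?N r i i'] i by simp
qed

text \<open>
  A repeated index makes the determinant vanish; otherwise sorting the row and column indices
  changes it by a sign only and turns it into a minor.
\<close>

lemma det_variables_mem:
  fixes \<rho> :: "nat \<Rightarrow> 'm::{finite,linorder}" and \<gamma> :: "nat \<Rightarrow> 'n::{finite,linorder}"
  assumes "\<forall>i<r. \<rho> i \<in> A" "\<forall>j<r. \<gamma> j \<in> C" "A \<times> C \<subseteq> B"
  shows "det (mat r r (\<lambda>(i, j). variable (\<rho> i, \<gamma> j)))
    \<in> (ideal_gen (minors_in B r) :: ('m, 'n, 'k::field) mpoly set)"
proof -
  let ?J = "ideal_gen (minors_in B r) :: ('m, 'n, 'k) mpoly set"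
  have J: "ring_module.subspace ?J" by (simp add: ideal_gen_def)
  let ?R = "\<rho> ` {0..<r}" and ?C = "\<gamma> ` {0..<r}"
  let ?x = "\<lambda>i j. variable (i, j) :: ('m, 'n, 'k) mpoly"
  have transpose: "det (mat r r (\<lambda>(i, j). ?x (f i) (\<gamma> j))) = det (mat r r (\<lambda>(j, i). ?x (f i) (\<gamma> j)))" for f \<gamma>
  proof -
    have "mat r r (\<lambda>(j, i). ?x (f i) (\<gamma> j)) = transpose_mat (mat r r (\<lambda>(i, j). ?x (f i) (\<gamma> j)))"
      by (intro eq_matI) auto
    then show ?thesis using det_transpose[of "mat r r (\<lambda>(i, j). ?x (f i) (\<gamma> j))" r] by simp
  qed
  show ?thesis
  proof (cases "inj_on \<rho> {0..<r} \<and> inj_on \<gamma> {0..<r}")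
    case True
    obtain c where c: "det (mat r r (\<lambda>(i, j). ?x (\<rho> i) (\<gamma> j)))
        = c * det (mat r r (\<lambda>(i, j). ?x (sorted_list_of_set ?R ! i) (\<gamma> j)))"
      using det_rows_of_set[of \<rho> r "\<lambda>i j. ?x i (\<gamma> j)"] True by blast
    obtain d where d: "det (mat r r (\<lambda>(j, i). ?x (sorted_list_of_set ?R ! i) (\<gamma> j)))
        = d * det (mat r r (\<lambda>(j, i). ?x (sorted_list_of_set ?R ! i) (sorted_list_of_set ?C ! j)))"
      using det_rows_of_set[of \<gamma> r "\<lambda>j i. ?x (sorted_list_of_set ?R ! i) j"] True by blast
    have card: "card ?R = r" "card ?C = r" using True by (simp_all add: card_image)
    have "det (mat r r (\<lambda>(i, j). ?x (\<rho> i) (\<gamma> j))) = c * (d * minor ?R ?C)"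
      unfolding c minor_def card transpose[of "\<lambda>i. sorted_list_of_set ?R ! i" \<gamma>] d
      using transpose[of "\<lambda>i. sorted_list_of_set ?R ! i" "\<lambda>j. sorted_list_of_set ?C ! j"] by simp
    moreover have "?R \<times> ?C \<subseteq> B" using assms by fastforce
    then have "minor ?R ?C \<in> minors_in B r"
      unfolding minors_in_def minor_indices_def using card by blast
    then have "minor ?R ?C \<in> ?J" unfolding ideal_gen_def by (rule ring_module.span_base)
    ultimately show ?thesis using J by (simp add: ring_module.subspace_scale)
  next
    case False
    then have "det (mat r r (\<lambda>(i, j). ?x (\<rho> i) (\<gamma> j))) = 0"
      using det_zero_of_repeated_row_index[of \<rho> r "\<lambda>i j. ?x i (\<gamma> j)"]
        det_zero_of_repeated_row_index[of \<gamma> r "\<lambda>j i. ?x (\<rho> i) j"] transpose[of \<rho> \<gamma>] by auto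
    then show ?thesis using J ring_module.subspace_0 by simp
  qed
qed

section \<open>Leading monomials of determinants\<close>

lemma prod_variable:
  "(\<Prod>i\<in>S. variable (v i)) = (power_product (\<Sum>i\<in>S. Poly_Mapping.single (v i) 1) :: ('m, 'n, 'k::field) mpoly)"
  by (induction S rule: infinite_finite_induct)
    (simp_all add: variable_def power_product_def mult_single)

lemma lookup_sum_single:
  "finite S \<Longrightarrow> Poly_Mapping.lookup (\<Sum>i\<in>S. Poly_Mapping.single (v i) (1::nat)) w = card {i\<in>S. v i = w}"
  by (simp add: lookup_sum lookup_single when_def sum.If_cases Int_def)

text \<open>
  The greatest moved variable \<open>z k\<close> decides: it exceeds all the variables that replace the moved
  ones, while the variables that are not moved contribute equally to both monomials.
\<close>

lemma (in variable_order) lex_less_permuted: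
  fixes n :: nat
  assumes dom: "\<And>i. i < n \<Longrightarrow> moved i \<Longrightarrow> \<exists>k<n. moved k \<and> gt (z k) (z' i)"
    and fixed: "\<And>i. i < n \<Longrightarrow> \<not> moved i \<Longrightarrow> z' i = z i"
    and "i < n" "moved i"
  shows "lex_less gt (\<Sum>i\<in>{0..<n}. Poly_Mapping.single (z' i) 1) (\<Sum>i\<in>{0..<n}. Poly_Mapping.single (z i) 1)"
proof -
  let ?V = "z ` {k. k < n \<and> moved k}"
  have "?V \<noteq> {}" using assms(3,4) by auto
  from ex_greatest[OF this] obtain v where
    v: "v \<in> ?V" "\<And>w. w \<in> ?V \<Longrightarrow> w \<noteq> v \<Longrightarrow> gt v w"
    by metis
  have small: "gt v (z' i)" if i: "i < n" "moved i" for i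
  proof -
    obtain k where k: "k < n" "moved k" "gt (z k) (z' i)" using dom[OF i] by blast
    moreover from this have "z k \<in> ?V" by blast
    ultimately show ?thesis using v(2)[of "z k"] gt_trans[of v "z k" "z' i"] by (cases "z k = v") auto
  qed
  let ?F = "\<lambda>w. {i\<in>{0..<n}. \<not> moved i \<and> z i = w}"
  have above: "z' i \<noteq> w" if "w = v \<or> gt w v" "i < n" "moved i" for i w
    using small[OF that(2,3)] that(1) gt_irrefl gt_trans by metis
  have above': "z i \<noteq> w" if "gt w v" "i < n" "moved i" for i w
  proof -
    have "z i \<in> ?V" using that by blast
    then show ?thesis using v(2)[of "z i"] that(1) gt_irrefl gt_trans by metis
  qed
  have left: "{i\<in>{0..<n}. z' i = w} = ?F w" if "w = v \<or> gt w v" for w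
  proof (rule Collect_cong)
    fix i
    show "(i \<in> {0..<n} \<and> z' i = w) = (i \<in> {0..<n} \<and> \<not> moved i \<and> z i = w)"
      using above[OF that, of i] fixed[of i] by (cases "moved i") auto
  qed
  have right: "{i\<in>{0..<n}. z i = w} = ?F w" if "gt w v" for w
  proof (rule Collect_cong)
    fix i
    show "(i \<in> {0..<n} \<and> z i = w) = (i \<in> {0..<n} \<and> \<not> moved i \<and> z i = w)"
      using above'[OF that, of i] by (cases "moved i") auto
  qed
  obtain k where k: "k < n" "moved k" "z k = v" using v(1) by (elim imageE CollectE conjE) simp
  have "k \<in> {i\<in>{0..<n}. z i = v}" "k \<notin> ?F v" using k by simp_all
  moreover have "?F v \<subseteq> {i\<in>{0..<n}. z i = v}" by (intro Collect_mono) simp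
  ultimately have "?F v \<subset> {i\<in>{0..<n}. z i = v}" by (metis psubsetI)
  then have "card (?F v) < card {i\<in>{0..<n}. z i = v}" by (intro psubset_card_mono) auto
  then have "card {i\<in>{0..<n}. z' i = v} < card {i\<in>{0..<n}. z i = v}" using left[of v] by simp
  moreover have "card {i\<in>{0..<n}. z' i = w} = card {i\<in>{0..<n}. z i = w}" if "gt w v" for w
    using left[of w] right[of w] that by simp
  ultimately show ?thesis
    unfolding lex_less_def lookup_sum_single[OF finite_atLeastLessThan] by blast
qed

text \<open>
  A criterion for the diagonal product to be the leading term: in the monomial of any other
  permutation avoiding the zero entries, every variable off the diagonal is smaller than some
  moved diagonal variable. Then the diagonal product comes from the identity alone and has
  coefficient one.
\<close>

lemma leads_det:
  fixes gt :: "'m::finite \<times> 'n::finite \<Rightarrow> 'm \<times> 'n \<Rightarrow> bool"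
  assumes "variable_order gt"
    and diag: "\<And>i. i < n \<Longrightarrow> \<not> Z i i"
    and dom: "\<And>\<sigma> i. \<sigma> permutes {0..<n} \<Longrightarrow> (\<And>j. j < n \<Longrightarrow> \<not> Z j (\<sigma> j)) \<Longrightarrow> i < n \<Longrightarrow> \<sigma> i \<noteq> i \<Longrightarrow>
        \<exists>k<n. \<sigma> k \<noteq> k \<and> gt (z k) (fst (z i), snd (z (\<sigma> i)))"
  shows "variable_order.leads gt
      (det (mat n n (\<lambda>(i, j). if Z i j then 0 else variable (fst (z i), snd (z j)))) :: ('m, 'n, 'k::field) mpoly)
      (\<Sum>i\<in>{0..<n}. Poly_Mapping.single (z i) 1)"
proof -
  interpret variable_order gt by fact
  let ?M = "mat n n (\<lambda>(i, j). if Z i j then 0 else variable (fst (z i), snd (z j))) :: ('m, 'n, 'k) mpoly mat"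
  let ?E = "\<lambda>\<sigma>. \<Sum>i\<in>{0..<n}. Poly_Mapping.single (fst (z i), snd (z (\<sigma> i))) (1::nat)"
  let ?P = "{\<sigma>. \<sigma> permutes {0..<n}}"
  let ?t = "\<lambda>\<sigma>. signof \<sigma> * (\<Prod>i = 0..<n. ?M $$ (i, \<sigma> i)) :: ('m, 'n, 'k) mpoly"
  have E_id: "?E id = (\<Sum>i\<in>{0..<n}. Poly_Mapping.single (z i) 1)" by simp
  have det: "det ?M = (\<Sum>\<sigma>\<in>?P. ?t \<sigma>)" by (rule det_def') simp
  have prod_eq: "(\<Prod>i = 0..<n. ?M $$ (i, \<sigma> i)) = power_product (?E \<sigma>)"
    if "\<sigma> permutes {0..<n}" "\<And>j. j < n \<Longrightarrow> \<not> Z j (\<sigma> j)" for \<sigma>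
  proof -
    have "(\<Prod>i = 0..<n. ?M $$ (i, \<sigma> i)) = (\<Prod>i = 0..<n. variable (fst (z i), snd (z (\<sigma> i))))"
    proof (rule prod.cong)
      fix i assume "i \<in> {0..<n}"
      moreover from this have "\<sigma> i < n" using permutes_in_image[OF that(1), of i] by simp
      ultimately show "?M $$ (i, \<sigma> i) = variable (fst (z i), snd (z (\<sigma> i)))" using that(2) by simp
    qed simp
    then show ?thesis by (simp add: prod_variable)
  qed
  have less: "lex_less gt s (?E id)"
    if \<sigma>: "\<sigma> permutes {0..<n}" "\<sigma> \<noteq> id" "s \<in> Poly_Mapping.keys (?t \<sigma>)" for \<sigma> s
  proof -
    have nz: "\<not> Z j (\<sigma> j)" if "j < n" for j
    proof
      assume "Z j (\<sigma> j)"
      moreover have "\<sigma> j < n" using permutes_in_image[OF \<sigma>(1), of j] that by simp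
      ultimately have "?M $$ (j, \<sigma> j) = 0" using that by simp
      then have "(\<Prod>i = 0..<n. ?M $$ (i, \<sigma> i)) = 0" using that by (intro prod_zero) auto
      then show False using \<sigma>(3) by simp
    qed
    have "(\<Prod>i = 0..<n. ?M $$ (i, \<sigma> i)) = power_product (?E \<sigma>)"
      using \<sigma>(1) nz by (rule prod_eq)
    then have "s \<in> Poly_Mapping.keys (signof \<sigma> * power_product (?E \<sigma>) :: ('m, 'n, 'k) mpoly)"
      using \<sigma>(3) by (simp only:)
    then have "s = ?E \<sigma>"
      by (auto simp: sign_def power_product_def split: if_splits)
    moreover obtain i where i: "i < n" "\<sigma> i \<noteq> i"
    proof -
      obtain i where "\<sigma> i \<noteq> i" using \<sigma>(2) by (auto simp: fun_eq_iff)
      moreover from this have "i \<in> {0..<n}" using \<sigma>(1) permutes_not_in by metis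
      ultimately show thesis using that by simp
    qed
    have dom': "\<exists>k<n. \<sigma> k \<noteq> k \<and> gt (z k) (fst (z i), snd (z (\<sigma> i)))" if "i < n" "\<sigma> i \<noteq> i" for i
      using dom[OF \<sigma>(1)] nz that by blast
    have "lex_less gt (?E \<sigma>) (?E id)"
      using lex_less_permuted[where moved = "\<lambda>i. \<sigma> i \<noteq> i" and z = z and n = n
          and z' = "\<lambda>i. (fst (z i), snd (z (\<sigma> i)))", OF dom' _ i]
      unfolding E_id by auto
    ultimately show ?thesis by simp
  qed
  have t_id: "?t id = power_product (?E id)"
  proof -
    have "(\<Prod>i = 0..<n. ?M $$ (i, id i)) = power_product (?E id)"
      by (rule prod_eq[of id]) (simp_all add: permutes_id diag)
    then show ?thesis by (simp only: sign_id of_int_1 mult_1_left)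
  qed
  define T where "T \<sigma> = ?t \<sigma>" for \<sigma>
  define e where "e = ?E id"
  have det_T: "det ?M = (\<Sum>\<sigma>\<in>?P. T \<sigma>)" unfolding T_def by (rule det)
  have T_id: "T id = power_product e" unfolding T_def e_def by (rule t_id)
  have less_T: "lex_less gt s e" if "\<sigma> \<in> ?P" "\<sigma> \<noteq> id" "Poly_Mapping.lookup (T \<sigma>) s \<noteq> 0" for \<sigma> s
  proof -
    have "s \<in> Poly_Mapping.keys (?t \<sigma>)" using that(3) unfolding T_def in_keys_iff .
    moreover have "\<sigma> permutes {0..<n}" using that(1) by (rule CollectD)
    ultimately show ?thesis unfolding e_def using that(2) by (intro less)
  qed
  have "Poly_Mapping.lookup (T \<sigma>) e = 0" if "\<sigma> \<in> ?P - {id}" for \<sigma>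
    using less_T[of \<sigma> e] that lex_less_irrefl[of e] by auto
  then have "(\<Sum>\<sigma>\<in>?P - {id}. Poly_Mapping.lookup (T \<sigma>) e) = 0" by (intro sum.neutral) simp
  moreover have "id \<in> ?P" by (simp add: permutes_id)
  ultimately have "Poly_Mapping.lookup (det ?M) e = 1"
    unfolding det_T lookup_sum
    by (simp add: sum.remove[of ?P id] finite_permutations T_id power_product_def)
  then have "e \<in> Poly_Mapping.keys (det ?M)" by (simp add: in_keys_iff)
  moreover have "lex_less gt s e" if s: "s \<in> Poly_Mapping.keys (det ?M)" "s \<noteq> e" for s
  proof -
    have "(\<Sum>\<sigma>\<in>?P. Poly_Mapping.lookup (T \<sigma>) s) \<noteq> 0"
      using s(1) unfolding det_T in_keys_iff lookup_sum .
    then obtain \<sigma> where \<sigma>: "\<sigma> \<in> ?P" "Poly_Mapping.lookup (T \<sigma>) s \<noteq> 0"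
      by (rule sum.not_neutral_contains_not_neutral)
    have "\<sigma> \<noteq> id"
      using \<sigma>(2) s(2) T_id by (auto simp: power_product_def lookup_single when_def)
    then show ?thesis using less_T \<sigma> by blast
  qed
  ultimately have "leads (det ?M) e" unfolding leads_def by blast
  then show ?thesis unfolding e_def E_id .
qed

text \<open>
  The leading monomials computed below depend on the scanning order through its monotonicity only:
  along steps to the south and east, variables decrease for the
  two orders starting in the northwest corner and increase for the other two.
\<close>

lemma scanning_order:
  assumes "gt \<in> scanning_orders"
  shows "variable_order gt"
    and "(\<forall>i j k l. i \<le> k \<longrightarrow> j \<le> l \<longrightarrow> (i, j) \<noteq> (k, l) \<longrightarrow> gt (i, j) (k, l)) \<or>
      (\<forall>i j k l. i \<le> k \<longrightarrow> j \<le> l \<longrightarrow> (i, j) \<noteq> (k, l) \<longrightarrow> gt (k, l) (i, j))"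
proof -
  consider "gt = gt_NW_rows" | "gt = gt_NW_cols" | "gt = gt_SE_rows" | "gt = gt_SE_cols"
    using assms by (auto simp: scanning_orders_def)
  then have "variable_order gt \<and>
      ((\<forall>i j k l. i \<le> k \<longrightarrow> j \<le> l \<longrightarrow> (i, j) \<noteq> (k, l) \<longrightarrow> gt (i, j) (k, l)) \<or>
      (\<forall>i j k l. i \<le> k \<longrightarrow> j \<le> l \<longrightarrow> (i, j) \<noteq> (k, l) \<longrightarrow> gt (k, l) (i, j)))"
  proof cases
    case 1
    then show ?thesis by (auto simp: gt_NW_rows_def variable_order_def)
  next
    case 2
    then show ?thesis by (auto simp: gt_NW_cols_def variable_order_def)
  next
    case 3
    then show ?thesis by (auto simp: gt_SE_rows_def variable_order_def)
  next
    case 4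
    then show ?thesis by (auto simp: gt_SE_cols_def variable_order_def)
  qed
  then show "variable_order gt"
    and "(\<forall>i j k l. i \<le> k \<longrightarrow> j \<le> l \<longrightarrow> (i, j) \<noteq> (k, l) \<longrightarrow> gt (i, j) (k, l)) \<or>
      (\<forall>i j k l. i \<le> k \<longrightarrow> j \<le> l \<longrightarrow> (i, j) \<noteq> (k, l) \<longrightarrow> gt (k, l) (i, j))" by blast+
qed

definition northwest :: "'m::linorder \<times> 'n::linorder \<Rightarrow> 'm \<times> 'n \<Rightarrow> bool" where
  "northwest x y \<longleftrightarrow> fst x < fst y \<and> snd x < snd y"

lemma northwest_trans: "northwest x y \<Longrightarrow> northwest y z \<Longrightarrow> northwest x z"
  by (auto simp: northwest_def)

text \<open>
  For three consecutive index ranges \<open>{0..<s}\<close>, \<open>{s..<p}\<close> and \<open>{p..<n}\<close> this is the block matrix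
  with rows and columns taken from the points \<open>z i\<close> in which the block with rows in the second and
  columns in the third range is replaced by zero. For \<open>s = p = n\<close> it is an ordinary submatrix of
  the generic matrix.
\<close>

definition zero_corner_matrix ::
  "nat \<Rightarrow> nat \<Rightarrow> nat \<Rightarrow> (nat \<Rightarrow> 'm \<times> 'n) \<Rightarrow> ('m, 'n, 'k::field) mpoly mat" where
  "zero_corner_matrix s p n z = mat n n (\<lambda>(i, j).
     if s \<le> i \<and> i < p \<and> p \<le> j then 0 else variable (fst (z i), snd (z j)))"

text \<open>
  The first range followed by the second or by the third range forms a chain running to the
  southeast, and no point of the second range lies weakly northeast of a point of the third one.
  Then the diagonal product is the leading monomial for all four scanning orders, for two
  different reasons.

  If variables increase towards the southeast, an entry at \<open>(fst (z i), snd (z j))\<close> is smaller than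
  \<open>z i\<close> or than \<open>z j\<close> unless \<open>z j\<close> lies weakly northeast of \<open>z i\<close>; among distinct \<open>i\<close> and \<open>j\<close> this
  is excluded within a chain, by \<open>sep\<close> if \<open>i\<close> is in the third and \<open>j\<close> in the second range, and by the
  zero block in the opposite case.

  If variables decrease towards the southeast, the first moved point of the first range dominates
  everything else that is moved. If no point of the first range is moved, the zero block forces the
  permutation to preserve the second and the third range, and within a chain the northwestern one
  of \<open>z i\<close> and \<open>z j\<close> dominates.
\<close>

lemma leads_det_zero_corner_matrix:
  fixes gt :: "'m::{finite,linorder} \<times> 'n::{finite,linorder} \<Rightarrow> 'm \<times> 'n \<Rightarrow> bool"
  assumes gt: "gt \<in> scanning_orders" and "s \<le> p" "p \<le> n"
    and chain1: "\<And>i j. i < j \<Longrightarrow> j < p \<Longrightarrow> northwest (z i) (z j)"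
    and chain2: "\<And>i j. i < j \<Longrightarrow> j < n \<Longrightarrow> i < s \<or> p \<le> i \<Longrightarrow> p \<le> j \<Longrightarrow> northwest (z i) (z j)"
    and sep: "\<And>i j. s \<le> i \<Longrightarrow> i < p \<Longrightarrow> p \<le> j \<Longrightarrow> j < n \<Longrightarrow>
        fst (z j) < fst (z i) \<or> snd (z i) < snd (z j)"
  shows "variable_order.leads gt (det (zero_corner_matrix s p n z :: ('m, 'n, 'k::field) mpoly mat))
      (\<Sum>i\<in>{0..<n}. Poly_Mapping.single (z i) 1)"
  unfolding zero_corner_matrix_def
proof (rule leads_det[OF scanning_order(1)[OF gt]])
  fix \<sigma> i
  assume \<sigma>: "\<sigma> permutes {0..<n}" and nz: "\<And>j. j < n \<Longrightarrow> \<not> (s \<le> j \<and> j < p \<and> p \<le> \<sigma> j)"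
    and i: "i < n" "\<sigma> i \<noteq> i"
  have inj: "\<sigma> x = \<sigma> y \<Longrightarrow> x = y" for x y using permutes_inj[OF \<sigma>] by (auto dest: injD)
  define j where "j = \<sigma> i"
  have j: "j < n" using permutes_in_image[OF \<sigma>, of i] i(1) by (simp add: j_def)
  have j_moved: "\<sigma> j \<noteq> j" using inj[of j i] i(2) by (auto simp: j_def)
  have ij: "i \<noteq> j" using i(2) by (simp add: j_def)
  have witness: "\<exists>k<n. \<sigma> k \<noteq> k \<and> gt (z k) (fst (z i), snd (z \<sigma>i))"
    if "gt (z i) (fst (z i), snd (z \<sigma>i)) \<or> gt (z j) (fst (z i), snd (z \<sigma>i))" for \<sigma>i
    using that i j j_moved by blast
  have same_chain: "northwest (z i) (z j) \<or> northwest (z j) (z i)"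
    if "(i < s \<or> p \<le> i) = (j < s \<or> p \<le> j) \<or> i < s \<or> j < s"
    using that ij i(1) j chain1[of i j] chain1[of j i] chain2[of i j] chain2[of j i] assms(2) by linarith
  from scanning_order(2)[OF gt] show "\<exists>k<n. \<sigma> k \<noteq> k \<and> gt (z k) (fst (z i), snd (z (\<sigma> i)))"
  proof
    assume SE: "\<forall>i j k l. i \<le> k \<longrightarrow> j \<le> l \<longrightarrow> (i, j) \<noteq> (k, l) \<longrightarrow> gt (k, l) (i, j)"
    have "fst (z i) < fst (z j) \<or> snd (z j) < snd (z i)"
    proof (cases "(i < s \<or> p \<le> i) = (j < s \<or> p \<le> j) \<or> i < s \<or> j < s")
      case True
      then show ?thesis using same_chain by (auto simp: northwest_def)
    next
      case False
      then show ?thesis using sep[of j i] nz[OF i(1)] i(1) j unfolding j_def by auto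
    qed
    then have "gt (fst (z i), snd (z i)) (fst (z i), snd (z j)) \<or>
        gt (fst (z j), snd (z j)) (fst (z i), snd (z j))"
      using SE by (metis less_imp_le less_irrefl order_refl prod.inject)
    then show ?thesis using witness unfolding j_def by simp
  next
    assume NW: "\<forall>i j k l. i \<le> k \<longrightarrow> j \<le> l \<longrightarrow> (i, j) \<noteq> (k, l) \<longrightarrow> gt (i, j) (k, l)"
    show ?thesis
    proof (cases "\<exists>k<s. \<sigma> k \<noteq> k")
      case True
      define k where "k = (LEAST k. k < s \<and> \<sigma> k \<noteq> k)"
      have k: "k < s" "\<sigma> k \<noteq> k" using LeastI_ex[OF True] unfolding k_def by blast+
      have least: "\<sigma> l = l" if "l < k" for l
      proof -
        have "\<not> (l < s \<and> \<sigma> l \<noteq> l)" using that unfolding k_def by (rule not_less_Least)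
        then show ?thesis using that k(1) by simp
      qed
      have below: "l = k \<or> northwest (z k) (z l)" if l: "l < n" "\<sigma> l \<noteq> l" for l
      proof -
        have "\<not> l < k" using least l(2) by blast
        then consider "l = k" | "k < l" "l < p" | "k < l" "p \<le> l" by linarith
        then show ?thesis using chain1[of k l] chain2[of k l] k(1) l(1) by cases simp_all
      qed
      have "fst (z k) \<le> fst (z i)" "snd (z k) \<le> snd (z j)"
          "fst (z k) < fst (z i) \<or> snd (z k) < snd (z j)"
        using below[OF i] below[OF j j_moved] ij by (auto simp: northwest_def)
      moreover from this(3) have "(fst (z k), snd (z k)) \<noteq> (fst (z i), snd (z j))"
        by (metis less_irrefl prod.inject)
      ultimately have "gt (fst (z k), snd (z k)) (fst (z i), snd (z j))" using NW by blast
      then show ?thesis using k assms(2,3) unfolding j_def by (intro exI[of _ k]) simp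
    next
      case False
      then have fixed: "\<sigma> k = k" if "k < s" for k using that by blast
      have T: "\<sigma> ` {s..<p} \<subseteq> {s..<p}"
      proof
        fix y assume "y \<in> \<sigma> ` {s..<p}"
        then obtain x where x: "x \<in> {s..<p}" "y = \<sigma> x" by blast
        have "\<not> y < s" using fixed[of y] inj[of y x] x by auto
        then show "y \<in> {s..<p}" using nz[of x] x assms(3) by auto
      qed
      have "inj_on \<sigma> {s..<p}" using inj by (auto intro: inj_onI)
      then have surj: "\<sigma> ` {s..<p} = {s..<p}" using endo_inj_surj[OF _ T] by simp
      have "s \<le> i" "s \<le> j" using fixed i(2) j_moved by (meson not_le)+
      moreover have "i < p \<longleftrightarrow> j < p"
      proof
        assume "i < p"
        then have "j \<in> \<sigma> ` {s..<p}" using \<open>s \<le> i\<close> by (auto simp: j_def)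
        then show "j < p" using surj by simp
      next
        assume "j < p"
        then have "j \<in> \<sigma> ` {s..<p}" using surj \<open>s \<le> j\<close> by simp
        then obtain i' where "i' \<in> {s..<p}" "\<sigma> i' = \<sigma> i" unfolding j_def by auto
        then show "i < p" using inj[of i' i] by simp
      qed
      ultimately have "northwest (z i) (z j) \<or> northwest (z j) (z i)"
        using same_chain by auto
      then have "gt (fst (z i), snd (z i)) (fst (z i), snd (z j)) \<or>
          gt (fst (z j), snd (z j)) (fst (z i), snd (z j))"
        using NW unfolding northwest_def by (metis less_imp_le less_irrefl order_refl prod.inject)
      then show ?thesis using witness unfolding j_def by simp
    qed
  qed
qed auto

lemma leads_minor:
  fixes gt :: "'m::{finite,linorder} \<times> 'n::{finite,linorder} \<Rightarrow> 'm \<times> 'n \<Rightarrow> bool"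
  assumes gt: "gt \<in> scanning_orders" and card: "card R = r" "card C = r"
  shows "variable_order.leads gt (minor R C :: ('m, 'n, 'k::field) mpoly)
      (\<Sum>i\<in>{0..<r}. Poly_Mapping.single (sorted_list_of_set R ! i, sorted_list_of_set C ! i) 1)"
proof -
  let ?z = "\<lambda>i. (sorted_list_of_set R ! i, sorted_list_of_set C ! i)"
  have "minor R C = (det (zero_corner_matrix r r r ?z) :: ('m, 'n, 'k) mpoly)"
    unfolding minor_def zero_corner_matrix_def card
    by (rule arg_cong[where f = det], rule eq_matI) auto
  moreover have "northwest (?z i) (?z j)" if "i < j" "j < r" for i j
    using that card by (simp add: northwest_def sorted_wrt_nth_less[OF strict_sorted_list_of_set])
  ultimately show ?thesis
    using leads_det_zero_corner_matrix[OF gt, of r r r ?z, where 'k = 'k] by simp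
qed

section \<open>Common multiples of minors in two rectangles\<close>

text \<open>
  The chains \<open>u\<close> and \<open>v\<close> are the diagonals of a minor in the tall rectangle \<open>{c..a} \<times> {d..b}\<close> and of
  one in the wide rectangle \<open>{c..a'} \<times> {d..b'}\<close> with the same northwest corner. If \<open>u\<close> and \<open>v\<close> are
  disjoint, the product of the two minors would do; common points are the difficulty.

  The chains are cut at a common position \<open>s\<close>, as late as possible, such that the first \<open>s\<close> points
  \<open>P\<close> of one of them can be continued by the rest of either chain and lie in the intersection of
  the rectangles. As no later cut is possible, the tail of \<open>u\<close> runs southwest of the tail of \<open>v\<close>.
  Now \<open>h\<close> is the determinant with rows and columns from \<open>P\<close>, the tail of \<open>u\<close> and the tail of \<open>v\<close>,
  with zeros where rows of the tail of \<open>u\<close> meet columns of the tail of \<open>v\<close>. The columns of \<open>P\<close> and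
  the tail of \<open>u\<close> are \<open>p\<close> full columns of variables from the tall rectangle, so \<open>h\<close> is a combination of
  \<open>p\<close>-minors of \<open>B1\<close>; likewise the rows of \<open>P\<close> and the tail of \<open>v\<close> are \<open>q\<close> full rows of variables
  from the wide rectangle, so \<open>h\<close> is a combination of \<open>q\<close>-minors of \<open>B2\<close>.
\<close>

lemma ex_common_multiple:
  fixes gt :: "'m::{finite,linorder} \<times> 'n::{finite,linorder} \<Rightarrow> 'm \<times> 'n \<Rightarrow> bool"
    and u v :: "nat \<Rightarrow> 'm \<times> 'n"
  assumes gt: "gt \<in> scanning_orders"
    and u: "\<And>i j. i < j \<Longrightarrow> j < p \<Longrightarrow> northwest (u i) (u j)"
      "\<And>i. i < p \<Longrightarrow> u i \<in> {c..a} \<times> {d..b}"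
    and v: "\<And>i j. i < j \<Longrightarrow> j < q \<Longrightarrow> northwest (v i) (v j)"
      "\<And>i. i < q \<Longrightarrow> v i \<in> {c..a'} \<times> {d..b'}"
    and ab: "a' \<le> a" "b \<le> b'"
    and B: "{c..a} \<times> {d..b} \<subseteq> B1" "{c..a'} \<times> {d..b'} \<subseteq> B2"
  shows "\<exists>h\<in>ideal_gen (minors_in B1 p) \<inter> (ideal_gen (minors_in B2 q) :: ('m, 'n, 'k::field) mpoly set).
      \<exists>(n::nat) z. variable_order.leads gt h (\<Sum>i\<in>{0..<n}. Poly_Mapping.single (z i) 1) \<and>
        inj_on z {0..<n} \<and> z ` {0..<n} \<subseteq> u ` {0..<p} \<union> v ` {0..<q}"
proof -
  \<comment> \<open>The comparisons with \<open>a'\<close> and \<open>b\<close> keep \<open>P\<close> in both rectangles where one chain has no further point to compare with.\<close>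
  define good where "good s \<longleftrightarrow> s = 0 \<or>
      fst (u (s - 1)) \<le> a' \<and> (s < q \<longrightarrow> northwest (u (s - 1)) (v s)) \<or>
      snd (v (s - 1)) \<le> b \<and> (s < p \<longrightarrow> northwest (v (s - 1)) (u s))" for s
  let ?m = "min p q"
  have "finite {s. s \<le> ?m \<and> good s}" "0 \<in> {s. s \<le> ?m \<and> good s}" by (auto simp: good_def)
  then obtain s where s: "s \<le> ?m" "good s" and max: "\<And>t. s < t \<Longrightarrow> t \<le> ?m \<Longrightarrow> \<not> good t"
    using Max_in[of "{s. s \<le> ?m \<and> good s}"] Max_ge[of "{s. s \<le> ?m \<and> good s}"]
    by (metis (mono_tags, lifting) empty_iff leD mem_Collect_eq)
  \<comment> \<open>Downward induction: the impossibility of a cut after \<open>t\<close> leaves only the two strict positions, and northeast at \<open>t\<close> would force northeast at \<open>Suc t\<close>.\<close>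
  have southwest: "fst (v t) < fst (u t) \<and> snd (u t) < snd (v t)" if "s \<le> t" "t < ?m" for t
    using that
  proof (induction "?m - t" arbitrary: t rule: less_induct)
    case less
    have IH: "fst (v (Suc t)) < fst (u (Suc t)) \<and> snd (u (Suc t)) < snd (v (Suc t))"
      if "Suc t < ?m"
    proof -
      have "?m - Suc t < ?m - t" using that by linarith
      then show ?thesis using less.hyps[of "Suc t"] less.prems(1) that by simp
    qed
    have ut: "northwest (u t) (u (Suc t))" if "Suc t < p" using u(1) that by simp
    have vt: "northwest (v t) (v (Suc t))" if "Suc t < q" using v(1) that by simp
    have box: "fst (v t) \<le> a'" "snd (u t) \<le> b"
      using u(2)[of t] v(2)[of t] less.prems by (auto simp: mem_Times_iff)
    have "\<not> good (Suc t)" using max[of "Suc t"] less.prems by simp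
    then have 1: "a' < fst (u t) \<or> Suc t < q \<and> \<not> northwest (u t) (v (Suc t))"
      and 2: "b < snd (v t) \<or> Suc t < p \<and> \<not> northwest (v t) (u (Suc t))"
      by (auto simp: good_def)
    have row: "snd (u t) < snd (v t)" if "fst (v t) < fst (u t)"
      using 2
    proof
      assume "b < snd (v t)"
      then show ?thesis using box by simp
    next
      assume "Suc t < p \<and> \<not> northwest (v t) (u (Suc t))"
      then show ?thesis using ut that by (auto simp: northwest_def)
    qed
    have "fst (v t) < fst (u t)"
    proof (rule ccontr)
      assume not: "\<not> fst (v t) < fst (u t)"
      then have "Suc t < q" "\<not> northwest (u t) (v (Suc t))" using 1 box by auto
      then have col: "snd (v (Suc t)) \<le> snd (u t)" "snd (v t) < snd (u t)"
        using not vt by (auto simp: northwest_def)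
      then have "Suc t < p" using 2 box by auto
      then show False using IH \<open>Suc t < q\<close> ut col by (auto simp: northwest_def)
    qed
    then show ?case using row by simp
  qed
  obtain P where P: "\<And>i j. i < j \<Longrightarrow> j < s \<Longrightarrow> northwest (P i) (P j)"
      "\<And>i. i < s \<Longrightarrow> P i \<in> {c..a'} \<times> {d..b}" "\<And>i. i < s \<Longrightarrow> P i \<in> u ` {0..<p} \<union> v ` {0..<q}"
    and Pu: "0 < s \<Longrightarrow> s < p \<Longrightarrow> northwest (P (s - 1)) (u s)"
    and Pv: "0 < s \<Longrightarrow> s < q \<Longrightarrow> northwest (P (s - 1)) (v s)"
  proof -
    have sp: "s \<le> p" "s \<le> q" using s(1) by auto
    from s(2) consider "s = 0"
      | "0 < s" "fst (u (s - 1)) \<le> a'" "s < q \<longrightarrow> northwest (u (s - 1)) (v s)"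
      | "0 < s" "snd (v (s - 1)) \<le> b" "s < p \<longrightarrow> northwest (v (s - 1)) (u s)"
      by (auto simp: good_def)
    then show thesis
    proof cases
      case 1
      then show thesis using that[of u] by simp
    next
      case 2
      have "fst (u i) \<le> a'" if "i < s" for i
      proof (cases "i = s - 1")
        case False
        then have "i < s - 1" "s - 1 < p" using that sp by linarith+
        then have "fst (u i) < fst (u (s - 1))" using u(1) by (simp add: northwest_def)
        then show ?thesis using 2(2) by (metis less_imp_le order_trans)
      qed (use 2(2) in simp)
      then have "u i \<in> {c..a'} \<times> {d..b}" if "i < s" for i
        using u(2)[of i] that sp by (auto simp: mem_Times_iff)
      then show thesis using 2 sp u(1) by (intro that[of u]) auto
    next
      case 3
      have "snd (v i) \<le> b" if "i < s" for i
      proof (cases "i = s - 1")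
        case False
        then have "i < s - 1" "s - 1 < q" using that sp by linarith+
        then have "snd (v i) < snd (v (s - 1))" using v(1) by (simp add: northwest_def)
        then show ?thesis using 3(2) by (metis less_imp_le order_trans)
      qed (use 3(2) in simp)
      then have "v i \<in> {c..a'} \<times> {d..b}" if "i < s" for i
        using v(2)[of i] that sp by (auto simp: mem_Times_iff)
      then show thesis using 3 sp v(1) by (intro that[of v]) auto
    qed
  qed
  have P_last: "P i = P (s - 1) \<or> northwest (P i) (P (s - 1))" if "i < s" for i
  proof (cases "i = s - 1")
    case False
    then show ?thesis using P(1)[of i "s - 1"] that by linarith
  qed simp
  have Pu': "northwest (P i) (u j)" if "i < s" "s \<le> j" "j < p" for i j
  proof -
    have "northwest (P (s - 1)) (u s)" using Pu that by linarith
    then have "northwest (P i) (u s)" using P_last[OF that(1)] northwest_trans by metis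
    moreover have "j = s \<or> northwest (u s) (u j)" using u(1)[of s j] that by linarith
    ultimately show ?thesis using northwest_trans by metis
  qed
  have Pv': "northwest (P i) (v j)" if "i < s" "s \<le> j" "j < q" for i j
  proof -
    have "northwest (P (s - 1)) (v s)" using Pv that by linarith
    then have "northwest (P i) (v s)" using P_last[OF that(1)] northwest_trans by metis
    moreover have "j = s \<or> northwest (v s) (v j)" using v(1)[of s j] that by linarith
    ultimately show ?thesis using northwest_trans by metis
  qed
  define n where "n = p + q - s"
  define z where "z i = (if i < s then P i else if i < p then u i else v (i - p + s))" for i
  have n: "s \<le> p" "p \<le> n" "n - p = q - s" "s \<le> q" using s(1) by (auto simp: n_def)
  have tail: "s \<le> i - p + s" "i - p + s < q" if "p \<le> i" "i < n" for i
    using that n by auto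
  have chain1: "northwest (z i) (z j)" if "i < j" "j < p" for i j
    using that P(1) Pu' u(1) by (auto simp: z_def)
  have chain2: "northwest (z i) (z j)" if "i < j" "j < n" "i < s \<or> p \<le> i" "p \<le> j" for i j
    using that n Pv'[of i "j - p + s"] v(1)[of "i - p + s" "j - p + s"] tail[of j]
    by (auto simp: z_def)
  have sep: "fst (z j) < fst (z i) \<or> snd (z i) < snd (z j)" if "s \<le> i" "i < p" "p \<le> j" "j < n" for i j
  proof -
    let ?k = "j - p + s"
    have z: "z i = u i" "z j = v ?k" using that n by (auto simp: z_def)
    have k: "s \<le> ?k" "?k < q" using tail that by auto
    show ?thesis
    proof (cases "i \<le> ?k")
      case True
      then have "snd (u i) < snd (v i)" using southwest[of i] that k by simp
      moreover have "snd (v i) \<le> snd (v ?k)"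
        using v(1)[of i ?k] True k by (cases "i = ?k") (auto simp: northwest_def)
      ultimately show ?thesis using z by auto
    next
      case False
      then have "fst (v ?k) < fst (u ?k)" using southwest[of ?k] that k by simp
      moreover have "fst (u ?k) \<le> fst (u i)"
        using u(1)[of ?k i] False that by (auto simp: northwest_def)
      ultimately show ?thesis using z by auto
    qed
  qed
  let ?N = "zero_corner_matrix s p n z :: ('m, 'n, 'k) mpoly mat"
  have carrier: "?N \<in> carrier_mat n n" by (simp add: zero_corner_matrix_def)
  have sub: "ring_module.subspace (ideal_gen G)" for G :: "('m, 'n, 'k) mpoly set"
    by (simp add: ideal_gen_def)
  have rows: "c \<le> fst (z i)" "fst (z i) \<le> a" "d \<le> snd (z i)" "snd (z i) \<le> b'" if "i < n" for i
    using P(2)[of i] u(2)[of i] v(2)[of "i - p + s"] tail[of i] that n ab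
    by (auto simp: z_def mem_Times_iff)
  have left: "snd (z j) \<le> b" if "j < p" for j
    using P(2)[of j] u(2)[of j] that by (auto simp: z_def mem_Times_iff)
  have top: "fst (z i) \<le> a'" if "i < s \<or> p \<le> i" "i < n" for i
    using P(2)[of i] v(2)[of "i - p + s"] tail[of i] that n by (auto simp: z_def mem_Times_iff)
  have "det ?N \<in> ideal_gen (minors_in B1 p)"
  proof (rule det_mem_of_column_minors[where e = "\<lambda>i j. variable (i, j)" and r = p
        and A = "{c..a}" and C = "{d..b}" and S = "{0..<p}"
        and \<rho> = "\<lambda>i. fst (z i)" and \<gamma> = "\<lambda>j. snd (z j)", OF sub])
    show "det (mat p p (\<lambda>(i, j). variable (\<rho> i, \<gamma> j))) \<in> ideal_gen (minors_in B1 p)"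
      if "\<forall>i<p. \<rho> i \<in> {c..a}" "\<forall>j<p. \<gamma> j \<in> {d..b}" for \<rho> \<gamma>
      using det_variables_mem[OF that B(1)] .
    show "\<forall>i<n. \<forall>j\<in>{0..<p}. ?N $$ (i, j) = variable (fst (z i), snd (z j))"
      using n by (auto simp: zero_corner_matrix_def)
  qed (use carrier n rows left in auto)
  moreover have "det ?N \<in> ideal_gen (minors_in B2 q)"
  proof (rule det_mem_of_row_minors[where e = "\<lambda>i j. variable (i, j)" and r = q
        and A = "{c..a'}" and C = "{d..b'}" and S = "{0..<s} \<union> {p..<n}"
        and \<rho> = "\<lambda>i. fst (z i)" and \<gamma> = "\<lambda>j. snd (z j)", OF sub])
    show "det (mat q q (\<lambda>(i, j). variable (\<rho> i, \<gamma> j))) \<in> ideal_gen (minors_in B2 q)"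
      if "\<forall>i<q. \<rho> i \<in> {c..a'}" "\<forall>j<q. \<gamma> j \<in> {d..b'}" for \<rho> \<gamma>
      using det_variables_mem[OF that B(2)] .
    show "\<forall>i\<in>{0..<s} \<union> {p..<n}. \<forall>j<n. ?N $$ (i, j) = variable (fst (z i), snd (z j))"
      using n by (auto simp: zero_corner_matrix_def)
    show "card ({0..<s} \<union> {p..<n}) = q"
      using n by (subst card_Un_disjoint) auto
  qed (use carrier n rows top in auto)
  moreover have "variable_order.leads gt (det ?N) (\<Sum>i\<in>{0..<n}. Poly_Mapping.single (z i) 1)"
    using leads_det_zero_corner_matrix[OF gt n(1,2) chain1 chain2 sep, where 'k = 'k] .
  moreover have "inj_on z {0..<n}"
  proof (rule linorder_inj_onI)
    fix i j assume ij: "i < j" "i \<in> {0..<n}" "j \<in> {0..<n}"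
    show "z i \<noteq> z j"
      using ij chain1[of i j] chain2[of i j] sep[of i j]
      by (cases "j < p"; cases "i < s \<or> p \<le> i") (auto simp: northwest_def)
  qed auto
  moreover have "z ` {0..<n} \<subseteq> u ` {0..<p} \<union> v ` {0..<q}"
  proof (rule image_subsetI)
    fix i assume i: "i \<in> {0..<n}"
    consider "i < s" | "s \<le> i" "i < p" | "p \<le> i" by linarith
    then show "z i \<in> u ` {0..<p} \<union> v ` {0..<q}"
    proof cases
      case 1
      then show ?thesis using P(3)[of i] by (simp add: z_def)
    next
      case 2
      then show ?thesis by (simp add: z_def)
    next
      case 3
      then have "i - p + s \<in> {0..<q}" using tail[of i] i by simp
      then have "v (i - p + s) \<in> v ` {0..<q}" by (rule imageI)
      then show ?thesis using 3 n(1) by (simp add: z_def)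
    qed
  qed
  ultimately show ?thesis by blast
qed

text \<open>
  A squarefree monomial divides the least common multiple of the two others as soon as each of its
  variables occurs in one of them.
\<close>

lemma lookup_sum_single_le:
  fixes x y z :: "nat \<Rightarrow> 'v"
  assumes "inj_on z {0..<n}" "z ` {0..<n} \<subseteq> x ` {0..<p} \<union> y ` {0..<q}"
  shows "Poly_Mapping.lookup (\<Sum>i\<in>{0..<n}. Poly_Mapping.single (z i) (1::nat)) w
    \<le> max (Poly_Mapping.lookup (\<Sum>i\<in>{0..<p}. Poly_Mapping.single (x i) (1::nat)) w)
        (Poly_Mapping.lookup (\<Sum>i\<in>{0..<q}. Poly_Mapping.single (y i) (1::nat)) w)"
proof (cases "w \<in> z ` {0..<n}")
  case False
  then have "{i\<in>{0..<n}. z i = w} = {}" by auto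
  then show ?thesis unfolding lookup_sum_single[OF finite_atLeastLessThan] by (simp only: card.empty)
next
  case True
  then obtain k where k: "k \<in> {0..<n}" "z k = w" by blast
  have "{i\<in>{0..<n}. z i = w} \<subseteq> {k}" using inj_onD[OF assms(1)] k by auto
  then have "card {i\<in>{0..<n}. z i = w} \<le> 1" using card_mono[of "{k}"] by fastforce
  moreover have "1 \<le> card {i\<in>{0..<p}. x i = w} \<or> 1 \<le> card {i\<in>{0..<q}. y i = w}"
  proof -
    have pos: "1 \<le> card {i\<in>{0..<l}. f i = w}" if "w \<in> f ` {0..<l}" for f :: "nat \<Rightarrow> 'v" and l
    proof -
      have "{i\<in>{0..<l}. f i = w} \<noteq> {}" using that by auto
      then have "0 < card {i\<in>{0..<l}. f i = w}" unfolding card_gt_0_iff by simp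
      then show ?thesis by simp
    qed
    have "w \<in> x ` {0..<p} \<or> w \<in> y ` {0..<q}" using assms(2) True by blast
    then show ?thesis using pos by blast
  qed
  ultimately show ?thesis unfolding lookup_sum_single[OF finite_atLeastLessThan] by linarith
qed

lemma minors_common_multiple:
  fixes gt :: "'m::{finite,linorder} \<times> 'n::{finite,linorder} \<Rightarrow> 'm \<times> 'n \<Rightarrow> bool"
  assumes gt: "gt \<in> scanning_orders" and diagonal: "diagonal B1" "diagonal B2" and pos: "1 \<le> p" "1 \<le> q"
    and RC: "(R, C) \<in> minor_indices B1 p" "(R', C') \<in> minor_indices B2 q"
    and corners: "(c, d) \<in> B1 \<inter> B2" "(a, b) \<in> B1" "(a', b') \<in> B2"
    and bounds: "R \<subseteq> {c..a}" "C \<subseteq> {d..b}" "R' \<subseteq> {c..a'}" "C' \<subseteq> {d..b'}"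
    and ab: "a' \<le> a" "b \<le> b'"
  shows "\<exists>h\<in>ideal_gen (minors_in B1 p) \<inter> (ideal_gen (minors_in B2 q) :: ('m, 'n, 'k::field) mpoly set).
      \<exists>s. variable_order.leads gt h s \<and> (\<forall>v. Poly_Mapping.lookup s v
        \<le> max (Poly_Mapping.lookup (lead_exponent gt (minor R C :: ('m, 'n, 'k) mpoly)) v)
            (Poly_Mapping.lookup (lead_exponent gt (minor R' C' :: ('m, 'n, 'k) mpoly)) v))"
proof -
  have card: "card R = p" "card C = p" "card R' = q" "card C' = q"
    using RC by (auto simp: minor_indices_def)
  let ?u = "\<lambda>i. (sorted_list_of_set R ! i, sorted_list_of_set C ! i)"
  let ?v = "\<lambda>i. (sorted_list_of_set R' ! i, sorted_list_of_set C' ! i)"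
  have nth_mem: "sorted_list_of_set S ! i \<in> S" if "i < card S" for S :: "'a::{finite,linorder} set" and i
    using nth_mem[of i "sorted_list_of_set S"] that by simp
  have nth_mono: "sorted_list_of_set S ! i < sorted_list_of_set S ! j" if "i < j" "j < card S"
    for S :: "'a::{finite,linorder} set" and i j
    using that by (simp add: sorted_wrt_nth_less[OF strict_sorted_list_of_set])
  have "R \<noteq> {}" "C \<noteq> {}" "R' \<noteq> {}" "C' \<noteq> {}" using card pos by auto
  then have nonempty: "c \<le> a" "d \<le> b" "c \<le> a'" "d \<le> b'"
    using bounds by fastforce+
  have B: "{c..a} \<times> {d..b} \<subseteq> B1" "{c..a'} \<times> {d..b'} \<subseteq> B2"
    using diagonal corners nonempty unfolding diagonal_def by blast+
  have u1: "northwest (?u i) (?u j)" if "i < j" "j < p" for i j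
    using nth_mono[of i j R] nth_mono[of i j C] that card by (simp add: northwest_def)
  have u2: "?u i \<in> {c..a} \<times> {d..b}" if "i < p" for i
    using nth_mem[of i R] nth_mem[of i C] that card bounds(1,2) by auto
  have v1: "northwest (?v i) (?v j)" if "i < j" "j < q" for i j
    using nth_mono[of i j R'] nth_mono[of i j C'] that card by (simp add: northwest_def)
  have v2: "?v i \<in> {c..a'} \<times> {d..b'}" if "i < q" for i
    using nth_mem[of i R'] nth_mem[of i C'] that card bounds(3,4) by auto
  have "\<exists>h\<in>ideal_gen (minors_in B1 p) \<inter> (ideal_gen (minors_in B2 q) :: ('m, 'n, 'k) mpoly set).
      \<exists>(n::nat) z. variable_order.leads gt h (\<Sum>i\<in>{0..<n}. Poly_Mapping.single (z i) 1) \<and>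
        inj_on z {0..<n} \<and> z ` {0..<n} \<subseteq> ?u ` {0..<p} \<union> ?v ` {0..<q}"
    using u1 u2 v1 v2 ab B by (rule ex_common_multiple[OF gt, of p ?u c a d b q ?v a' b' B1 B2])
  then obtain h and n :: nat and z where
      h: "h \<in> ideal_gen (minors_in B1 p) \<inter> (ideal_gen (minors_in B2 q) :: ('m, 'n, 'k) mpoly set)"
      "variable_order.leads gt h (\<Sum>i\<in>{0..<n}. Poly_Mapping.single (z i) 1)"
    and z: "inj_on z {0..<n}" "z ` {0..<n} \<subseteq> ?u ` {0..<p} \<union> ?v ` {0..<q}"
    by (elim bexE exE conjE)
  note lead = lead_exponent_eq[OF scanning_order(1)[OF gt] leads_minor[OF gt card(1,2), where 'k = 'k]]
    lead_exponent_eq[OF scanning_order(1)[OF gt] leads_minor[OF gt card(3,4), where 'k = 'k]]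
  show ?thesis
    using h lookup_sum_single_le[OF z] unfolding lead by blast
qed

theorem proposition3p6:
  fixes gt :: "'m::{finite,linorder} \<times> 'n::{finite,linorder} \<Rightarrow> 'm \<times> 'n \<Rightarrow> bool"
    and k :: nat
    and B :: "nat \<Rightarrow> ('m \<times> 'n) set"
    and r :: "nat \<Rightarrow> nat"
  assumes "CARD('m) \<le> CARD('n)"
    and "gt \<in> scanning_orders"
    and "\<And>i. i \<in> {1..k} \<Longrightarrow> diagonal (B i)"
    and "\<And>i. i \<in> {1..k} \<Longrightarrow> r i \<ge> 1"
    and "\<And>i. i \<in> {1..k} \<Longrightarrow>
           groebner_basis gt (minors_in (B i) (r i) :: ('m, 'n, 'k::field) mpoly set)
             (ideal_gen (minors_in (B i) (r i)))"
    and "\<And>i j Ri Ci Rj Cj.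
           \<lbrakk>i \<in> {1..k}; j \<in> {1..k}; i \<noteq> j;
            (Ri, Ci) \<in> minor_indices (B i) (r i); (Rj, Cj) \<in> minor_indices (B j) (r j)\<rbrakk> \<Longrightarrow>
           \<exists>c d a b a' b'.
             (c, d) \<in> B i \<inter> B j \<and> (a, b) \<in> B i \<and> (a', b') \<in> B j \<and>
             Ri \<subseteq> {c..a} \<and> Ci \<subseteq> {d..b} \<and> Rj \<subseteq> {c..a'} \<and> Cj \<subseteq> {d..b'} \<and>
             (a \<ge> a' \<and> b \<le> b' \<or> a \<le> a' \<and> b \<ge> b')"
  shows "groebner_basis gt (blockwise_minors k B r :: ('m, 'n, 'k) mpoly set)
           (blockwise_ideal k B r)"
  unfolding blockwise_ideal_def blockwise_minors_def
proof (rule groebner_basis_Union[OF scanning_order(1)[OF assms(2)] finite_atLeastAtMost assms(5)])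
  fix i j and g g' :: "('m, 'n, 'k) mpoly"
  assume ij: "i \<in> {1..k}" "j \<in> {1..k}" "i \<noteq> j"
    and g: "g \<in> minors_in (B i) (r i)" and g': "g' \<in> minors_in (B j) (r j)"
  obtain R C where RC: "g = minor R C" "(R, C) \<in> minor_indices (B i) (r i)"
    using g by (auto simp: minors_in_def)
  obtain R' C' where RC': "g' = minor R' C'" "(R', C') \<in> minor_indices (B j) (r j)"
    using g' by (auto simp: minors_in_def)
  obtain c d a b a' b' where corners: "(c, d) \<in> B i \<inter> B j" "(a, b) \<in> B i" "(a', b') \<in> B j"
    and bounds: "R \<subseteq> {c..a}" "C \<subseteq> {d..b}" "R' \<subseteq> {c..a'}" "C' \<subseteq> {d..b'}"
    and ab: "a \<ge> a' \<and> b \<le> b' \<or> a \<le> a' \<and> b \<ge> b'"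
    using assms(6)[OF ij RC(2) RC'(2)] by blast
  from ab show "\<exists>h\<in>ideal_gen (minors_in (B i) (r i)) \<inter> (ideal_gen (minors_in (B j) (r j)) :: ('m, 'n, 'k) mpoly set).
      \<exists>s. variable_order.leads gt h s \<and> (\<forall>v. Poly_Mapping.lookup s v
        \<le> max (Poly_Mapping.lookup (lead_exponent gt g) v) (Poly_Mapping.lookup (lead_exponent gt g') v))"
  proof
    assume "a' \<le> a \<and> b \<le> b'"
    then show ?thesis
      unfolding RC(1) RC'(1)
      using minors_common_multiple[OF assms(2) assms(3)[OF ij(1)] assms(3)[OF ij(2)]
          assms(4)[OF ij(1)] assms(4)[OF ij(2)] RC(2) RC'(2) corners bounds, where 'k = 'k] by blast
  next
    assume "a \<le> a' \<and> b' \<le> b"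
    then show ?thesis
      unfolding RC(1) RC'(1)
      using minors_common_multiple[OF assms(2) assms(3)[OF ij(2)] assms(3)[OF ij(1)]
          assms(4)[OF ij(2)] assms(4)[OF ij(1)] RC'(2) RC(2) _ corners(3,2) bounds(3,4,1,2), where 'k = 'k] corners(1)
      by (simp add: Int_commute max.commute)
  qed
qed

end
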